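(* Let $K$ be an algebraically closed field of positive characteristic $p\neq 2$ and let $m,n\geq 1$ be integers. Then the algebra $A_s$ of supersymmetric polynomials in $x_1,\ldots,x_m,y_1,\ldots,y_n$ over $K$ is generated, as an algebra over its subalgebra $A_s(p)$, by the elements $c_r$ for $r\geq 0$.
   Context: $A_s$ is the $K$-algebra of all polynomials $f(x|y)=f(x_1,\ldots,x_m,y_1,\ldots,y_n)\in K[x_1,\ldots,x_m,y_1,\ldots,y_n]$ that are symmetric in $x_1,\ldots,x_m$ and in $y_1,\ldots,y_n$ separately and satisfy $\frac{d}{dT}\big(f(x|y)|_{x_1=y_1=T}\big)=0$, where $T$ is a new variable substituted for both $x_1$ and $y_1$. A homogeneous polynomial $f(x|y)=\sum_\lambda a_\lambda x_1^{\lambda_1}\cdots x_m^{\lambda_m}y_1^{\lambda_{m+1}}\cdots y_n^{\lambda_{m+n}}$ is called $p$-balanced if $p\mid(\lambda_i+\lambda_j)$ whenever $1\leq i\leq m<j\leq m+n$ and $a_\lambda\neq 0$. $A_s(p)$ is the subalgebra of $A_s$ generated by the $p$-balanced polynomials lying in $A_s$. For $r\geq 0$, $c_r=\sum_{0\leq i\leq \min(r,m)}(-1)^{r-i}\sigma_i(x_1,\ldots,x_m)\,p_{r-i}(y_1,\ldots,y_n)$, where $\sigma_i$ is the $i$-th elementary symmetric polynomial and $p_j$ is the $j$-th complete (homogeneous) symmetric polynomial ($\sigma_0=p_0=1$). *)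

theory Defs
  imports
    "HOL-Library.Poly_Mapping"
    "HOL-Library.Multiset"
    "HOL-Combinatorics.Permutations"
    "HOL-Computational_Algebra.Computational_Algebra"
begin

text \<open>
  Monomials are exponent functions of finite support and polynomials are finitely supported
  coefficient functions on monomials, with the convolution product. The variable
  $x_i$ ($1 \le i \le m$) has index $i$ and $y_j$ ($1 \le j \le n$) has index $m + j$.
\<close>

type_synonym 'k mpoly = "(nat \<Rightarrow>\<^sub>0 nat) \<Rightarrow>\<^sub>0 'k"

definition const :: "'k::field \<Rightarrow> 'k mpoly" where
  "const c = Poly_Mapping.single 0 c"

definition var :: "nat \<Rightarrow> 'k::field mpoly" where
  "var i = Poly_Mapping.single (Poly_Mapping.single i 1) 1"

definition xy_polys :: "nat \<Rightarrow> nat \<Rightarrow> 'k::field mpoly set" where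
  "xy_polys m n = {f. \<forall>\<alpha>\<in>Poly_Mapping.keys f. Poly_Mapping.keys \<alpha> \<subseteq> {1..m + n}}"

text \<open>
  Substitution of \<open>\<sigma> i\<close> for the variable of index \<open>i\<close>; the map \<open>\<phi>\<close> embeds the coefficients
  into the target ring.
\<close>

definition substitute ::
    "('k::field \<Rightarrow> 'r::comm_ring_1) \<Rightarrow> (nat \<Rightarrow> 'r) \<Rightarrow> 'k mpoly \<Rightarrow> 'r" where
  "substitute \<phi> \<sigma> f = (\<Sum>\<alpha>\<in>Poly_Mapping.keys f.
     \<phi> (Poly_Mapping.lookup f \<alpha>) * (\<Prod>i\<in>Poly_Mapping.keys \<alpha>. \<sigma> i ^ Poly_Mapping.lookup \<alpha> i))"

definition symmetric_in :: "nat set \<Rightarrow> 'k::field mpoly \<Rightarrow> bool" where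
  "symmetric_in V f \<longleftrightarrow> (\<forall>\<pi>. \<pi> permutes V \<longrightarrow> substitute const (\<lambda>i. var (\<pi> i)) f = f)"

text \<open>
  $f|_{x_1 = y_1 = T}$ is a univariate polynomial in $T$ whose coefficients are
  polynomials in the remaining variables.
\<close>

definition subst_x1_y1 :: "nat \<Rightarrow> 'k::field mpoly \<Rightarrow> 'k mpoly poly" where
  "subst_x1_y1 m f =
     substitute (\<lambda>c. [:const c:]) (\<lambda>i. if i = 1 \<or> i = m + 1 then [:0, 1:] else [:var i:]) f"

definition A_s :: "nat \<Rightarrow> nat \<Rightarrow> 'k::field mpoly set" where
  "A_s m n = {f \<in> xy_polys m n.
     symmetric_in {1..m} f \<and> symmetric_in {m + 1..m + n} f \<and> pderiv (subst_x1_y1 m f) = 0}"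

definition homogeneous :: "'k::field mpoly \<Rightarrow> bool" where
  "homogeneous f \<longleftrightarrow> (\<exists>d. \<forall>\<alpha>\<in>Poly_Mapping.keys f.
     (\<Sum>i\<in>Poly_Mapping.keys \<alpha>. Poly_Mapping.lookup \<alpha> i) = d)"

definition p_balanced :: "nat \<Rightarrow> nat \<Rightarrow> nat \<Rightarrow> 'k::field mpoly \<Rightarrow> bool" where
  "p_balanced p m n f \<longleftrightarrow> homogeneous f \<and>
     (\<forall>\<alpha>\<in>Poly_Mapping.keys f. \<forall>i j. 1 \<le> i \<and> i \<le> m \<and> m < j \<and> j \<le> m + n \<longrightarrow>
        p dvd Poly_Mapping.lookup \<alpha> i + Poly_Mapping.lookup \<alpha> j)"

text \<open>
  For a subring \<open>B\<close> with unit: the \<open>B\<close>-subalgebras of the ambient ring, and the one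
  generated by \<open>X\<close>.
\<close>

definition subalgebra_over :: "'r::comm_ring_1 set \<Rightarrow> 'r set \<Rightarrow> bool" where
  "subalgebra_over B S \<longleftrightarrow> B \<subseteq> S \<and> (\<forall>f\<in>S. \<forall>g\<in>S. f + g \<in> S \<and> f - g \<in> S \<and> f * g \<in> S)"

definition algebra_generated :: "'r::comm_ring_1 set \<Rightarrow> 'r set \<Rightarrow> 'r set" where
  "algebra_generated B X = subalgebra_over B hull X"

definition A_s_p :: "nat \<Rightarrow> nat \<Rightarrow> nat \<Rightarrow> 'k::field mpoly set" where
  "A_s_p p m n = algebra_generated (range const) {f \<in> A_s m n. p_balanced p m n f}"

definition elem_sym :: "nat set \<Rightarrow> nat \<Rightarrow> 'k::field mpoly" where
  "elem_sym V i = (\<Sum>S | S \<subseteq> V \<and> card S = i. \<Prod>v\<in>S. var v)"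

definition complete_sym :: "nat set \<Rightarrow> nat \<Rightarrow> 'k::field mpoly" where
  "complete_sym V j = (\<Sum>M\<in>multisets_of_size V j. \<Prod>v\<in>#M. var v)"

definition c_gen :: "nat \<Rightarrow> nat \<Rightarrow> nat \<Rightarrow> 'k::field mpoly" where
  "c_gen m n r = (\<Sum>i\<in>{0..min r m}.
     (-1) ^ (r - i) * elem_sym {1..m} i * complete_sym {m + 1..m + n} (r - i))"

end

theory Submission
  imports Defs "Jordan_Normal_Form.Determinant"
begin

text \<open>
  One inclusion is a matter of checking that the generators are supersymmetric. For the other,
  let \<open>G\<close> be the subalgebra generated by the \<open>c\<^sub>r\<close> and the \<open>p\<close>-balanced polynomials; the
  latter include the powers \<open>\<sigma>\<^sub>j(y)\<^sup>p = \<sigma>\<^sub>j(y\<^sup>p)\<close>.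

  The idea is to compare a supersymmetric \<open>f\<close> with elements of \<open>G\<close> after identifying variables.
  Let \<open>\<rho>\<^sub>k\<close> (\<open>specialise m k\<close>) put \<open>y\<^sub>i = x\<^sub>i\<close> for \<open>i \<le> k\<close>, and split the surviving variables into
  \<open>T = {x\<^sub>1, \<dots>, x\<^sub>k}\<close>, \<open>X = {x\<^sub>k\<^sub>+\<^sub>1, \<dots>, x\<^sub>m}\<close> and \<open>Y = {y\<^sub>k\<^sub>+\<^sub>1, \<dots>, y\<^sub>n}\<close>. Supersymmetry of \<open>f\<close> makes
  \<open>\<rho>\<^sub>k f\<close> symmetric in each of the three blocks, and the vanishing derivative, in
  characteristic \<open>p\<close>, makes every exponent of a variable in \<open>T\<close> a multiple of \<open>p\<close>. Suppose in
  addition that \<open>\<rho>\<^sub>k\<^sub>+\<^sub>1 f = 0\<close>, or that \<open>k = min m n\<close>. Then \<open>\<rho>\<^sub>k f\<close> vanishes whenever some \<open>y \<in> Y\<close> is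
  identified with some \<open>x \<in> X\<close>, so it is divisible by the resultant
  \<open>R = \<Prod>\<^sub>x\<^sub>,\<^sub>y (x - y)\<close> over \<open>X\<close> and \<open>Y\<close>; the quotient inherits the symmetries and the condition on exponents, and the fundamental
  theorem on symmetric polynomials writes it as a polynomial in the \<open>\<sigma>\<^sub>j(T)\<^sup>p\<close>, \<open>\<sigma>\<^sub>j(X)\<close> and
  \<open>\<sigma>\<^sub>j(Y)\<close> (\<open>specialise_factorisation\<close>).

  Every such product lies in \<open>\<rho>\<^sub>k(G)\<close> (\<open>resultant_multiple_in_specialise_image\<close>). Without the block
  \<open>T\<close> this says that \<open>R\<close> times a polynomial symmetric in \<open>X\<close> and in \<open>Y\<close> is a polynomial in the
  elements \<open>c\<^sub>r(X|Y) = \<rho>\<^sub>k c\<^sub>r\<close>, which is classical and is proved here with Hankel determinants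
  of the sequence \<open>c\<^sub>r(X|Y)\<close> (\<open>resultant_multiple_in_alg_C\<close>). The factors \<open>\<sigma>\<^sub>j(T)\<^sup>p\<close> are then
  produced, by induction on \<open>j\<close>, from
  \<open>\<rho>\<^sub>k(\<sigma>\<^sub>j(y)\<^sup>p) = \<Sum>\<^sub>a \<sigma>\<^sub>j\<^sub>-\<^sub>a(T)\<^sup>p \<sigma>\<^sub>a(Y)\<^sup>p\<close>: the terms with \<open>a > 0\<close> have a factor \<open>\<sigma>\<^sub>i(T)\<^sup>p\<close> with
  \<open>i < j\<close>, and their other factor \<open>\<sigma>\<^sub>a(Y)\<^sup>p\<close> is absorbed by the symmetric multiple of \<open>R\<close>.

  So an \<open>f\<close> with \<open>\<rho>\<^sub>k\<^sub>+\<^sub>1 f = 0\<close> agrees under \<open>\<rho>\<^sub>k\<close> with an element of \<open>G\<close>. Subtracting it lowers \<open>k\<close>,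
  and \<open>\<rho>\<^sub>0\<close> is the identity; starting at \<open>k = min m n\<close>, where there is no condition on \<open>f\<close>, this
  puts every supersymmetric polynomial into \<open>G\<close>.
\<close>

section \<open>Ring homomorphisms and substitutions\<close>

text \<open>
  Homomorphisms are handled as a predicate on functions, because several different substitutions,
  with values in polynomials and in univariate polynomials over these, have to be composed and
  compared.
\<close>

definition rhom :: "('a::comm_ring_1 \<Rightarrow> 'b::comm_ring_1) \<Rightarrow> bool" where
  "rhom h \<longleftrightarrow> h 0 = 0 \<and> h 1 = 1 \<and> (\<forall>a b. h (a + b) = h a + h b) \<and> (\<forall>a b. h (a * b) = h a * h b)"

lemma rhomD:
  assumes "rhom h"
  shows "h 0 = 0" "h 1 = 1" "h (a + b) = h a + h b" "h (a * b) = h a * h b"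
  using assms by (auto simp: rhom_def)

lemma rhom_minus:
  assumes "rhom h"
  shows "h (- a) = - h a"
proof -
  have "h a + h (- a) = 0"
    using rhomD(3)[OF assms, of a "- a"] rhomD(1)[OF assms] by simp
  then show ?thesis by (simp add: eq_neg_iff_add_eq_0 add.commute)
qed

lemma rhom_diff:
  assumes "rhom h"
  shows "h (a - b) = h a - h b"
  using rhomD(3)[OF assms, of a "- b"] rhom_minus[OF assms, of b] by simp

lemma rhom_sum: "rhom h \<Longrightarrow> h (sum f A) = (\<Sum>x\<in>A. h (f x))"
  by (induction A rule: infinite_finite_induct) (simp_all add: rhomD)

lemma rhom_prod: "rhom h \<Longrightarrow> h (prod f A) = (\<Prod>x\<in>A. h (f x))"
  by (induction A rule: infinite_finite_induct) (simp_all add: rhomD)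

lemma rhom_power: "rhom h \<Longrightarrow> h (a ^ n) = h a ^ n"
  by (induction n) (simp_all add: rhomD)

lemmas rhom_simps = rhomD rhom_minus rhom_diff rhom_sum rhom_prod rhom_power

lemma rhom_comp: "rhom g \<Longrightarrow> rhom h \<Longrightarrow> rhom (\<lambda>x. g (h x))"
  by (simp add: rhom_def)

lemma rhom_const: "rhom (const :: 'k::field \<Rightarrow> 'k mpoly)"
  by (simp add: rhom_def const_def single_add mult_single)

lemma rhom_const_poly: "rhom (\<lambda>c::'k::field. [:const c:])"
  by (simp add: rhom_def rhomD[OF rhom_const])

lemma rhom_coeff_lift: "rhom (\<lambda>c::'a::comm_ring_1. [:c:])"
  by (simp add: rhom_def)

lemma rhom_map_poly:
  assumes h: "rhom h"
  shows "rhom (map_poly h)"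
proof -
  note [simp] = rhom_simps[OF h]
  have c: "coeff (map_poly h f) i = h (coeff f i)" for f i
    by (simp add: coeff_map_poly)
  have "map_poly h (f + g) = map_poly h f + map_poly h g"
    "map_poly h (f * g) = map_poly h f * map_poly h g" for f g
    by (auto intro!: poly_eqI simp: c coeff_mult)
  then show ?thesis by (simp add: rhom_def)
qed

lemma monomial_sum: "f = (\<Sum>\<alpha>\<in>Poly_Mapping.keys f. Poly_Mapping.single \<alpha> (Poly_Mapping.lookup f \<alpha>))"
  by (rule poly_mapping_eqI)
     (auto simp: lookup_sum lookup_single when_def in_keys_iff sum.delta)

lemma substitute_superset:
  assumes "rhom \<phi>" "finite A" "Poly_Mapping.keys f \<subseteq> A"
  shows "substitute \<phi> \<sigma> f = (\<Sum>\<alpha>\<in>A. \<phi> (Poly_Mapping.lookup f \<alpha>) *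
    (\<Prod>i\<in>Poly_Mapping.keys \<alpha>. \<sigma> i ^ Poly_Mapping.lookup \<alpha> i))"
  unfolding substitute_def using assms
  by (intro sum.mono_neutral_left) (auto simp: in_keys_iff rhomD)

lemma monomial_superset:
  fixes \<sigma> :: "nat \<Rightarrow> 'r::comm_ring_1"
  assumes "finite A" "Poly_Mapping.keys \<alpha> \<subseteq> A"
  shows "(\<Prod>i\<in>Poly_Mapping.keys \<alpha>. \<sigma> i ^ Poly_Mapping.lookup \<alpha> i) =
    (\<Prod>i\<in>A. \<sigma> i ^ Poly_Mapping.lookup \<alpha> i)"
  using assms by (intro prod.mono_neutral_left) (auto simp: in_keys_iff)

lemma monomial_add:
  fixes \<sigma> :: "nat \<Rightarrow> 'r::comm_ring_1"
  shows "(\<Prod>i\<in>Poly_Mapping.keys (\<alpha> + \<beta>). \<sigma> i ^ Poly_Mapping.lookup (\<alpha> + \<beta>) i) =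
    (\<Prod>i\<in>Poly_Mapping.keys \<alpha>. \<sigma> i ^ Poly_Mapping.lookup \<alpha> i) *
    (\<Prod>i\<in>Poly_Mapping.keys \<beta>. \<sigma> i ^ Poly_Mapping.lookup \<beta> i)"
proof -
  let ?A = "Poly_Mapping.keys \<alpha> \<union> Poly_Mapping.keys \<beta>"
  have s: "Poly_Mapping.keys (\<alpha> + \<beta>) \<subseteq> ?A" by (rule keys_add)
  show ?thesis
    unfolding monomial_superset[of ?A, OF _ s, simplified]
      monomial_superset[of ?A \<alpha>, simplified] monomial_superset[of ?A \<beta>, simplified]
    by (simp add: lookup_add power_add prod.distrib)
qed

lemma substitute_add:
  assumes "rhom \<phi>"
  shows "substitute \<phi> \<sigma> (f + g) = substitute \<phi> \<sigma> f + substitute \<phi> \<sigma> g"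
proof -
  let ?A = "Poly_Mapping.keys f \<union> Poly_Mapping.keys g"
  have s: "Poly_Mapping.keys (f + g) \<subseteq> ?A" by (rule keys_add)
  show ?thesis
    using s by (simp add: substitute_superset[OF assms, of ?A] lookup_add rhomD[OF assms]
      algebra_simps sum.distrib)
qed

lemma substitute_zero: "substitute \<phi> \<sigma> 0 = 0"
  by (simp add: substitute_def)

lemma substitute_sum:
  assumes "rhom \<phi>"
  shows "substitute \<phi> \<sigma> (sum f A) = (\<Sum>x\<in>A. substitute \<phi> \<sigma> (f x))"
  by (induction A rule: infinite_finite_induct) (auto simp: substitute_add[OF assms] substitute_zero)

lemma substitute_single:
  assumes "rhom \<phi>"
  shows "substitute \<phi> \<sigma> (Poly_Mapping.single \<alpha> c) =
    \<phi> c * (\<Prod>i\<in>Poly_Mapping.keys \<alpha>. \<sigma> i ^ Poly_Mapping.lookup \<alpha> i)"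
  by (subst substitute_superset[OF assms, of "{\<alpha>}"]) (auto split: if_splits)

lemma substitute_mult:
  assumes "rhom \<phi>"
  shows "substitute \<phi> \<sigma> (f * g) = substitute \<phi> \<sigma> f * substitute \<phi> \<sigma> g"
proof -
  have "substitute \<phi> \<sigma> (f * g) = substitute \<phi> \<sigma>
    ((\<Sum>\<alpha>\<in>Poly_Mapping.keys f. Poly_Mapping.single \<alpha> (Poly_Mapping.lookup f \<alpha>)) *
     (\<Sum>\<beta>\<in>Poly_Mapping.keys g. Poly_Mapping.single \<beta> (Poly_Mapping.lookup g \<beta>)))"
    using monomial_sum[of f] monomial_sum[of g] by simp
  also have "\<dots> = substitute \<phi> \<sigma> f * substitute \<phi> \<sigma> g"
    unfolding sum_product mult_single substitute_sum[OF assms] substitute_single[OF assms]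
      monomial_add rhomD[OF assms] substitute_def[of _ _ f] substitute_def[of _ _ g]
    by (simp add: mult_ac)
  finally show ?thesis .
qed

lemma rhom_substitute: "rhom \<phi> \<Longrightarrow> rhom (substitute \<phi> \<sigma>)"
  using substitute_single[of \<phi> \<sigma> 0 1]
  by (simp add: rhom_def substitute_add substitute_mult substitute_zero)

lemma substitute_const: "rhom \<phi> \<Longrightarrow> substitute \<phi> \<sigma> (const c) = \<phi> c"
  by (simp add: const_def substitute_single)

lemma substitute_var: "rhom \<phi> \<Longrightarrow> substitute \<phi> \<sigma> (var i) = \<sigma> i"
  by (simp add: var_def substitute_single rhomD)

abbreviation subst :: "(nat \<Rightarrow> 'k::field mpoly) \<Rightarrow> 'k mpoly \<Rightarrow> 'k mpoly" where
  "subst \<equiv> substitute const"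

lemmas rhom_subst = rhom_substitute[OF rhom_const]
lemmas subst_simps = rhom_simps[OF rhom_subst] substitute_const[OF rhom_const]
  substitute_var[OF rhom_const]

section \<open>Subalgebras\<close>

abbreviation subalgebra :: "'k::field mpoly set \<Rightarrow> bool" where
  "subalgebra \<equiv> subalgebra_over (range const)"

abbreviation alg :: "'k::field mpoly set \<Rightarrow> 'k mpoly set" where
  "alg \<equiv> algebra_generated (range const)"

lemma subalgebraD:
  assumes "subalgebra S"
  shows "const c \<in> S" "0 \<in> S" "1 \<in> S" "f \<in> S \<Longrightarrow> g \<in> S \<Longrightarrow> f + g \<in> S"
    "f \<in> S \<Longrightarrow> g \<in> S \<Longrightarrow> f - g \<in> S" "f \<in> S \<Longrightarrow> g \<in> S \<Longrightarrow> f * g \<in> S"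
    "f \<in> S \<Longrightarrow> - f \<in> S"
proof -
  show c: "const c \<in> S" for c using assms by (auto simp: subalgebra_over_def)
  show z: "0 \<in> S" "1 \<in> S" using c[of 0] c[of 1] by (simp_all add: rhomD[OF rhom_const])
  show "f \<in> S \<Longrightarrow> g \<in> S \<Longrightarrow> f + g \<in> S"
    "f \<in> S \<Longrightarrow> g \<in> S \<Longrightarrow> f - g \<in> S" "f \<in> S \<Longrightarrow> g \<in> S \<Longrightarrow> f * g \<in> S"
    using assms by (auto simp: subalgebra_over_def)
  show "f \<in> S \<Longrightarrow> - f \<in> S"
    using assms z by (metis diff_0 subalgebra_over_def)
qed

lemma subalgebraI:
  assumes "\<And>c. const c \<in> S" "\<And>f g. f \<in> S \<Longrightarrow> g \<in> S \<Longrightarrow> f + g \<in> S"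
    "\<And>f g. f \<in> S \<Longrightarrow> g \<in> S \<Longrightarrow> f * g \<in> S"
  shows "subalgebra S"
  unfolding subalgebra_over_def
proof (intro conjI ballI)
  show "range const \<subseteq> S" using assms by auto
  fix f g assume fg: "f \<in> S" "g \<in> S"
  show "f + g \<in> S" "f * g \<in> S" using fg assms by auto
  have "f - g = f + const (-1) * g"
    by (simp add: rhom_simps[OF rhom_const])
  then show "f - g \<in> S" using fg assms by metis
qed

lemma subalgebra_sum: "subalgebra S \<Longrightarrow> (\<And>x. x \<in> A \<Longrightarrow> f x \<in> S) \<Longrightarrow> sum f A \<in> S"
  by (induction A rule: infinite_finite_induct) (auto simp: subalgebraD)

lemma subalgebra_prod: "subalgebra S \<Longrightarrow> (\<And>x. x \<in> A \<Longrightarrow> f x \<in> S) \<Longrightarrow> prod f A \<in> S"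
  by (induction A rule: infinite_finite_induct) (auto simp: subalgebraD)

lemma subalgebra_power: "subalgebra S \<Longrightarrow> f \<in> S \<Longrightarrow> f ^ n \<in> S"
  by (induction n) (auto simp: subalgebraD)

lemma subalgebra_over_mono: "subalgebra_over B S \<Longrightarrow> C \<subseteq> B \<Longrightarrow> subalgebra_over C S"
  by (auto simp: subalgebra_over_def)

lemma algebra_generated_subalgebra: "subalgebra_over B (algebra_generated B X)"
  unfolding algebra_generated_def hull_def subalgebra_over_def by blast

lemma algebra_generated_superset: "X \<subseteq> algebra_generated B X"
  unfolding algebra_generated_def by (rule hull_subset)

lemma algebra_generated_minimal: "subalgebra_over B S \<Longrightarrow> X \<subseteq> S \<Longrightarrow> algebra_generated B X \<subseteq> S"
  unfolding algebra_generated_def by (rule hull_minimal)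

lemma algebra_generated_inc: "x \<in> X \<Longrightarrow> x \<in> algebra_generated B X"
  using algebra_generated_superset by blast

lemma subalgebra_vimage:
  assumes "subalgebra S" and h: "rhom h" "\<And>c. h (const c) = const c"
  shows "subalgebra {f. h f \<in> S}"
  by (rule subalgebraI) (auto simp: h rhomD[OF h(1)] subalgebraD[OF assms(1)])

lemma subalgebra_image:
  assumes S: "subalgebra S" and h: "rhom h" "\<And>c. h (const c) = const c"
  shows "subalgebra (h ` S)"
proof (rule subalgebraI)
  show "const c \<in> h ` S" for c
    using h(2)[of c] subalgebraD(1)[OF S] by (metis imageI)
next
  fix f g assume "f \<in> h ` S" "g \<in> h ` S"
  then obtain a b where ab: "a \<in> S" "b \<in> S" "f = h a" "g = h b" by auto
  then show "f + g \<in> h ` S" "f * g \<in> h ` S"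
    using rhomD(3,4)[OF h(1), of a b] subalgebraD(4,6)[OF S ab(1,2)] by (metis imageI)+
qed

definition polys_in :: "nat set \<Rightarrow> 'k::field mpoly set" where
  "polys_in V = {f. \<forall>\<alpha>\<in>Poly_Mapping.keys f. Poly_Mapping.keys \<alpha> \<subseteq> V}"

lemma xy_polys_polys_in: "xy_polys m n = polys_in {1..m + n}"
  by (simp add: xy_polys_def polys_in_def)

lemma subalgebra_polys_in: "subalgebra (polys_in V)"
proof (rule subalgebraI)
  show "const c \<in> polys_in V" for c by (simp add: polys_in_def const_def)
next
  fix f g :: "'a mpoly" assume fg: "f \<in> polys_in V" "g \<in> polys_in V"
  show "f + g \<in> polys_in V"
    using fg keys_add[of f g] by (auto simp: polys_in_def)
  show "f * g \<in> polys_in V"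
  proof -
    have "Poly_Mapping.keys \<gamma> \<subseteq> V" if \<gamma>: "\<gamma> \<in> Poly_Mapping.keys (f * g)" for \<gamma>
    proof -
      obtain \<alpha> \<beta> where ab: "\<alpha> \<in> Poly_Mapping.keys f" "\<beta> \<in> Poly_Mapping.keys g" "\<gamma> = \<alpha> + \<beta>"
        using \<gamma> keys_mult[of f g] by auto
      have "Poly_Mapping.keys \<alpha> \<subseteq> V" "Poly_Mapping.keys \<beta> \<subseteq> V"
        using fg ab(1,2) by (auto simp: polys_in_def)
      then show ?thesis using keys_add[of \<alpha> \<beta>] ab(3) by blast
    qed
    then show ?thesis by (simp add: polys_in_def)
  qed
qed

lemma var_in_polys_in: "i \<in> V \<Longrightarrow> var i \<in> polys_in V"
  by (simp add: polys_in_def var_def)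

lemma monomial_eq_prod_vars:
  "Poly_Mapping.single \<alpha> (c::'k::field) =
    const c * (\<Prod>i\<in>Poly_Mapping.keys \<alpha>. var i ^ Poly_Mapping.lookup \<alpha> i)"
proof -
  have p: "var i ^ k = Poly_Mapping.single (Poly_Mapping.single i k) (1::'k)" for i k
    by (induction k) (simp_all add: var_def mult_single single_add[symmetric] single_one)
  have "(\<Prod>i\<in>A. Poly_Mapping.single (Poly_Mapping.single i (Poly_Mapping.lookup \<alpha> i)) (1::'k)) =
    Poly_Mapping.single (\<Sum>i\<in>A. Poly_Mapping.single i (Poly_Mapping.lookup \<alpha> i)) 1" if "finite A" for A
    using that by induction (auto simp: mult_single single_one)
  then show ?thesis
    using monomial_sum[of \<alpha>] by (simp add: p const_def mult_single)
qed

text \<open>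
  Induction on the construction of a polynomial, in the form in which it is used below: a property
  whose extension is a subalgebra need only be verified for variables.
\<close>

lemma polys_in_subset_subalgebra:
  fixes S :: "'k::field mpoly set"
  assumes S: "subalgebra S" and V: "\<And>i. i \<in> V \<Longrightarrow> var i \<in> S"
  shows "polys_in V \<subseteq> S"
proof
  fix f :: "'k mpoly" assume f: "f \<in> polys_in V"
  have "Poly_Mapping.single \<alpha> (Poly_Mapping.lookup f \<alpha>) \<in> S" if "\<alpha> \<in> Poly_Mapping.keys f" for \<alpha>
    unfolding monomial_eq_prod_vars using f that
    by (intro subalgebraD[OF S] subalgebra_prod[OF S] subalgebra_power[OF S] V)
       (auto simp: polys_in_def)
  then show "f \<in> S"
    by (subst monomial_sum) (intro subalgebra_sum[OF S])
qed

lemma polys_in_UNIV: "f \<in> polys_in UNIV"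
  by (simp add: polys_in_def)

text \<open>
  The polynomials on which two homomorphisms agree form a subalgebra, so agreement on constants
  and on the variables that occur is enough. All identities between substitutions below are
  reduced to a check on variables in this way.
\<close>

lemma rhom_eqI:
  assumes g: "rhom g" and h: "rhom h" and c: "\<And>c. g (const c) = h (const c)"
    and v: "\<And>i. i \<in> V \<Longrightarrow> g (var i) = h (var i)" and f: "f \<in> polys_in V"
  shows "g f = h f"
proof -
  have "subalgebra {f. g f = h f}"
    by (rule subalgebraI) (auto simp: c rhomD[OF g] rhomD[OF h])
  from polys_in_subset_subalgebra[OF this, of V] v f show ?thesis by auto
qed

lemma subst_subst:
  "subst \<sigma> (subst \<tau> f) = subst (\<lambda>i. subst \<sigma> (\<tau> i)) f"
  by (rule rhom_eqI[OF rhom_comp[OF rhom_subst rhom_subst] rhom_subst _ _ polys_in_UNIV])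
     (auto simp: subst_simps)

lemma subst_cong:
  "f \<in> polys_in V \<Longrightarrow> (\<And>i. i \<in> V \<Longrightarrow> \<sigma> i = \<tau> i) \<Longrightarrow> subst \<sigma> f = subst \<tau> f"
  by (rule rhom_eqI[OF rhom_subst rhom_subst]) (auto simp: subst_simps)

lemma subst_var [simp]: "subst var f = f"
  by (rule rhom_eqI[OF rhom_subst _ _ _ polys_in_UNIV, where h = "\<lambda>x. x"])
     (auto simp: subst_simps rhom_def)

lemma subst_in_subalgebra:
  assumes S: "subalgebra S" and "\<And>i. i \<in> V \<Longrightarrow> \<sigma> i \<in> S" "f \<in> polys_in V"
  shows "subst \<sigma> f \<in> S"
  using polys_in_subset_subalgebra[OF subalgebra_vimage[OF S rhom_subst[of \<sigma>]], of V] assms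
  by (auto simp: subst_simps)

lemma CHAR_mpoly: "CHAR('k::field mpoly) = CHAR('k)"
proof (rule CHAR_eqI)
  have e: "of_nat k = (const (of_nat k) :: 'k mpoly)" for k
    by (simp add: const_def single_of_nat)
  show "of_nat (CHAR('k)) = (0 :: 'k mpoly)" by (simp add: e rhomD[OF rhom_const])
  show "CHAR('k) dvd k" if "of_nat k = (0 :: 'k mpoly)" for k
  proof -
    have "const (of_nat k) = (const 0 :: 'k mpoly)" using that by (simp add: e rhomD[OF rhom_const])
    then have "of_nat k = (0::'k)"
      unfolding const_def by (metis lookup_single_eq)
    then show ?thesis by (simp add: of_nat_eq_0_iff_char_dvd)
  qed
qed

section \<open>Generating functions\<close>

definition E_fps :: "nat set \<Rightarrow> (nat \<Rightarrow> 'a::comm_ring_1) \<Rightarrow> 'a fps" where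
  "E_fps V \<sigma> = (\<Prod>v\<in>V. 1 + fps_const (\<sigma> v) * fps_X)"

definition geo :: "'a::comm_ring_1 \<Rightarrow> 'a fps" where
  "geo a = Abs_fps (\<lambda>n. (- a) ^ n)"

definition H_fps :: "nat set \<Rightarrow> (nat \<Rightarrow> 'a::comm_ring_1) \<Rightarrow> 'a fps" where
  "H_fps V \<sigma> = (\<Prod>v\<in>V. geo (\<sigma> v))"

lemma geo_nth [simp]: "fps_nth (geo a) n = (- a) ^ n"
  by (simp add: geo_def)

lemma linear_fps_nth:
  fixes a :: "'a::comm_ring_1"
  shows "fps_nth ((1 + fps_const a * fps_X) * f) n = fps_nth f n + (if n = 0 then 0 else a * fps_nth f (n - 1))"
proof -
  have "(1 + fps_const a * fps_X) * f = f + fps_const a * (fps_X * f)"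
    by (simp only: distrib_right mult.assoc mult_1_left)
  then show ?thesis by simp
qed

text \<open>
  \<open>geo a\<close> is the expansion of \<open>1 / (1 + a X)\<close>; as the coefficient ring is not a field, the
  inverse is given by its coefficients.
\<close>

lemma linear_fps_geo: "(1 + fps_const a * fps_X) * geo a = 1"
proof (rule fps_ext)
  show "fps_nth ((1 + fps_const a * fps_X) * geo a) n = fps_nth 1 n" for n
    unfolding linear_fps_nth by (cases n) auto
qed

lemma E_fps_H_fps: "E_fps V \<sigma> * H_fps V \<sigma> = 1"
  by (simp add: E_fps_def H_fps_def prod.distrib[symmetric] linear_fps_geo)

lemma E_fps_empty [simp]: "E_fps {} \<sigma> = 1" and H_fps_empty [simp]: "H_fps {} \<sigma> = 1"
  by (simp_all add: E_fps_def H_fps_def)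

lemma E_fps_insert: "finite V \<Longrightarrow> v \<notin> V \<Longrightarrow>
    E_fps (insert v V) \<sigma> = (1 + fps_const (\<sigma> v) * fps_X) * E_fps V \<sigma>"
  and H_fps_insert: "finite V \<Longrightarrow> v \<notin> V \<Longrightarrow> H_fps (insert v V) \<sigma> = geo (\<sigma> v) * H_fps V \<sigma>"
  by (simp_all add: E_fps_def H_fps_def)

lemma E_fps_Un: "finite V \<Longrightarrow> finite W \<Longrightarrow> V \<inter> W = {} \<Longrightarrow>
    E_fps (V \<union> W) \<sigma> = E_fps V \<sigma> * E_fps W \<sigma>"
  and H_fps_Un: "finite V \<Longrightarrow> finite W \<Longrightarrow> V \<inter> W = {} \<Longrightarrow>
    H_fps (V \<union> W) \<sigma> = H_fps V \<sigma> * H_fps W \<sigma>"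
  by (simp_all add: E_fps_def H_fps_def prod.union_disjoint)

lemma E_fps_cong: "(\<And>v. v \<in> V \<Longrightarrow> \<sigma> v = \<tau> v) \<Longrightarrow> E_fps V \<sigma> = E_fps V \<tau>"
  and H_fps_cong: "(\<And>v. v \<in> V \<Longrightarrow> \<sigma> v = \<tau> v) \<Longrightarrow> H_fps V \<sigma> = H_fps V \<tau>"
  by (simp_all add: E_fps_def H_fps_def)

lemma E_fps_reindex: "bij_betw \<pi> V W \<Longrightarrow> E_fps V (\<lambda>v. \<sigma> (\<pi> v)) = E_fps W \<sigma>"
  and H_fps_reindex: "bij_betw \<pi> V W \<Longrightarrow> H_fps V (\<lambda>v. \<sigma> (\<pi> v)) = H_fps W \<sigma>"
  unfolding E_fps_def H_fps_def
  by (erule prod.reindex_bij_betw)+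

lemma E_fps_nth_0 [simp]: "fps_nth (E_fps V \<sigma>) 0 = 1"
  by (cases "finite V", induction V rule: finite_induct) (auto simp: E_fps_insert E_fps_def)

lemma E_fps_nth_eq_0: "finite V \<Longrightarrow> i > card V \<Longrightarrow> fps_nth (E_fps V \<sigma>) i = 0"
  by (induction V arbitrary: i rule: finite_induct) (auto simp: E_fps_insert linear_fps_nth)

definition fps_map :: "('a::comm_ring_1 \<Rightarrow> 'b::comm_ring_1) \<Rightarrow> 'a fps \<Rightarrow> 'b fps" where
  "fps_map h f = Abs_fps (\<lambda>n. h (fps_nth f n))"

lemma fps_map_nth [simp]: "fps_nth (fps_map h f) n = h (fps_nth f n)"
  by (simp add: fps_map_def)

lemma fps_map_mult:
  assumes h: "rhom h"
  shows "fps_map h (f * g) = fps_map h f * fps_map h g"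
  by (rule fps_ext) (simp add: fps_mult_nth rhom_simps[OF h])

lemma fps_map_prod:
  assumes h: "rhom h"
  shows "fps_map h (prod f A) = (\<Prod>x\<in>A. fps_map h (f x))"
proof -
  have one: "fps_map h 1 = 1"
    by (rule fps_ext) (simp add: rhomD[OF h])
  show ?thesis
    by (induction A rule: infinite_finite_induct) (simp_all add: one fps_map_mult[OF h])
qed

lemma fps_map_linear:
  assumes h: "rhom h"
  shows "fps_map h (1 + fps_const a * fps_X) = 1 + fps_const (h a) * fps_X"
  by (rule fps_ext) (simp add: rhom_simps[OF h] fps_X_def)

lemma fps_map_geo:
  assumes h: "rhom h"
  shows "fps_map h (geo a) = geo (h a)"
  by (rule fps_ext) (simp add: rhom_simps[OF h])

lemma fps_map_E_fps: "rhom h \<Longrightarrow> fps_map h (E_fps V \<sigma>) = E_fps V (\<lambda>v. h (\<sigma> v))"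
  by (simp add: E_fps_def fps_map_prod fps_map_linear)

lemma fps_map_H_fps: "rhom h \<Longrightarrow> fps_map h (H_fps V \<sigma>) = H_fps V (\<lambda>v. h (\<sigma> v))"
  by (simp add: H_fps_def fps_map_prod fps_map_geo)

lemma elem_sym_0: "finite V \<Longrightarrow> elem_sym V 0 = 1"
proof -
  assume "finite V"
  then have "{S. S \<subseteq> V \<and> card S = 0} = {{}}"
    by (auto dest: finite_subset)
  then show ?thesis by (simp add: elem_sym_def)
qed

lemma elem_sym_insert:
  assumes V: "finite V" "v \<notin> V"
  shows "elem_sym (insert v V) (Suc i) = elem_sym V (Suc i) + var v * elem_sym V i"
proof -
  let ?A = "{S. S \<subseteq> V \<and> card S = Suc i}"
  let ?B = "{S. S \<subseteq> V \<and> card S = i}"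
  have eq: "{S. S \<subseteq> insert v V \<and> card S = Suc i} = ?A \<union> insert v ` ?B"
  proof (intro equalityI subsetI)
    fix S assume S: "S \<in> {S. S \<subseteq> insert v V \<and> card S = Suc i}"
    show "S \<in> ?A \<union> insert v ` ?B"
    proof (cases "v \<in> S")
      case True
      then have "S = insert v (S - {v})" "S - {v} \<in> ?B" using S by auto
      then show ?thesis by blast
    qed (use S in auto)
  next
    fix S assume "S \<in> ?A \<union> insert v ` ?B"
    then show "S \<in> {S. S \<subseteq> insert v V \<and> card S = Suc i}"
      using V finite_subset[OF _ V(1)] by (auto simp: card_insert_if)
  qed
  have inj: "inj_on (insert v) ?B" using V(2) by (auto simp: inj_on_def)
  have "(\<Prod>w\<in>insert v S. var w) = (var v * (\<Prod>w\<in>S. var w) :: 'a mpoly)" if "S \<in> ?B" for S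
    using that V by (subst prod.insert) (auto dest: finite_subset)
  then have "(\<Sum>S\<in>insert v ` ?B. \<Prod>w\<in>S. var w) = (var v * elem_sym V i :: 'a mpoly)"
    by (simp add: sum.reindex[OF inj] elem_sym_def sum_distrib_left)
  moreover have "?A \<inter> insert v ` ?B = {}" using V by auto
  ultimately show ?thesis
    unfolding elem_sym_def eq using V by (subst sum.union_disjoint) (auto simp: elem_sym_def)
qed

lemma elem_sym_eq_E_fps: "finite V \<Longrightarrow> elem_sym V i = fps_nth (E_fps V var) i"
proof (induction V arbitrary: i rule: finite_induct)
  case empty
  have "{S. S \<subseteq> {} \<and> card S = Suc k} = {}" for k :: nat by auto
  then have "elem_sym {} (Suc k) = 0" for k
    unfolding elem_sym_def by (metis sum.empty)
  then show ?case by (cases i) (simp_all add: elem_sym_0)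
next
  case (insert v V)
  then show ?case
    by (cases i) (auto simp: elem_sym_0 elem_sym_insert E_fps_insert linear_fps_nth)
qed

lemma complete_sym_insert:
  assumes V: "finite V" "v \<notin> V"
  shows "complete_sym (insert v V) n = (\<Sum>m=0..n. var v ^ m * complete_sym V (n - m))"
proof -
  have fin: "finite (multisets_of_size V k)" for k
    using V(1) by (rule finite_multisets_of_size)
  have "(\<Sum>m=0..n. var v ^ m * complete_sym V (n - m)) =
    (\<Sum>(m, X)\<in>(SIGMA m:{0..n}. multisets_of_size V (n - m)).
      (\<Prod>v\<in># X + replicate_mset m v. var v) :: 'a mpoly)"
    by (simp add: complete_sym_def sum_distrib_left sum.Sigma fin mult.commute)
  also have "\<dots> = complete_sym (insert v V) n"
    unfolding complete_sym_def
    by (subst sum.reindex_bij_betw[OF bij_betw_multisets_of_size_insert[OF V(2)], symmetric])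
       (simp add: case_prod_unfold)
  finally show ?thesis by simp
qed

lemma complete_sym_eq_H_fps: "finite V \<Longrightarrow> (-1) ^ j * complete_sym V j = fps_nth (H_fps V var) j"
proof (induction V arbitrary: j rule: finite_induct)
  case empty
  then show ?case by (cases j) (auto simp: complete_sym_def)
next
  case (insert v V)
  have "(-1) ^ j * (var v ^ m * complete_sym V (j - m)) =
    (- var v) ^ m * ((-1) ^ (j - m) * complete_sym V (j - m) :: 'a mpoly)" if "m \<le> j" for m
  proof -
    have "(-1::'a mpoly) ^ j = (-1) ^ m * (-1) ^ (j - m)"
      using that by (simp add: power_add[symmetric])
    moreover have "(- var v :: 'a mpoly) ^ m = (-1) ^ m * var v ^ m" by (rule power_minus)
    ultimately show ?thesis by (simp add: mult_ac)
  qed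
  then show ?case
    using insert by (simp add: complete_sym_insert H_fps_insert fps_mult_nth sum_distrib_left)
qed

definition C_fps :: "nat set \<Rightarrow> nat set \<Rightarrow> (nat \<Rightarrow> 'a::comm_ring_1) \<Rightarrow> 'a fps" where
  "C_fps X Y \<sigma> = E_fps X \<sigma> * H_fps Y \<sigma>"

lemma fps_map_C_fps: "rhom h \<Longrightarrow> fps_map h (C_fps X Y \<sigma>) = C_fps X Y (\<lambda>v. h (\<sigma> v))"
  by (simp add: C_fps_def fps_map_mult fps_map_E_fps fps_map_H_fps)

text \<open>
  The generating function of the \<open>c\<^sub>r\<close> is \<open>\<Prod> (1 + x\<^sub>i X) / \<Prod> (1 + y\<^sub>j X)\<close>. Supersymmetry of the
  \<open>c\<^sub>r\<close> and their behaviour under identification of variables both amount to the cancellation of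
  equal factors of numerator and denominator.
\<close>

lemma c_gen_eq_C_fps: "c_gen m n r = fps_nth (C_fps {1..m} {m + 1..m + n} var) r"
proof -
  have "fps_nth (C_fps {1..m} {m + 1..m + n} var) r =
    (\<Sum>i=0..r. elem_sym {1..m} i * ((-1) ^ (r - i) * complete_sym {m + 1..m + n} (r - i) :: 'a mpoly))"
    by (simp add: C_fps_def fps_mult_nth elem_sym_eq_E_fps complete_sym_eq_H_fps)
  also have "\<dots> = (\<Sum>i=0..min r m. elem_sym {1..m} i * ((-1) ^ (r - i) * complete_sym {m + 1..m + n} (r - i)))"
    by (rule sum.mono_neutral_right) (auto simp: elem_sym_eq_E_fps E_fps_nth_eq_0)
  finally show ?thesis by (simp add: c_gen_def mult_ac)
qed

lemma rhom_elem_sym: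
  assumes "rhom h" "finite V"
  shows "h (elem_sym V i) = fps_nth (E_fps V (\<lambda>v. h (var v))) i"
  using fps_map_E_fps[OF assms(1), of V var, symmetric] by (simp add: elem_sym_eq_E_fps assms(2))

lemma rhom_c_gen:
  assumes "rhom h"
  shows "h (c_gen m n r) = fps_nth (C_fps {1..m} {m + 1..m + n} (\<lambda>v. h (var v))) r"
  using fps_map_C_fps[OF assms, of "{1..m}" "{m + 1..m + n}" var, symmetric]
  by (simp add: c_gen_eq_C_fps)

section \<open>Hankel determinants of linear recurrent sequences\<close>

text \<open>
  The action of \<open>q(w)\<close> on sequences, where \<open>w\<close> acts as the shift \<open>F \<mapsto> (\<lambda>s. F (s + 1))\<close>. A linear
  recurrence for \<open>F\<close> is a polynomial that annihilates it.
\<close>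

definition shift_op :: "'a::comm_ring_1 poly \<Rightarrow> (nat \<Rightarrow> 'a) \<Rightarrow> nat \<Rightarrow> 'a" where
  "shift_op q F s = (\<Sum>a\<le>Polynomial.degree q. Polynomial.coeff q a * F (s + a))"

lemma shift_op_superset:
  "Polynomial.degree q < N \<Longrightarrow> shift_op q F s = (\<Sum>a<N. Polynomial.coeff q a * F (s + a))"
  unfolding shift_op_def
  by (rule sum.mono_neutral_left) (auto simp: coeff_eq_0)

lemma shift_op_1 [simp]: "shift_op 1 F s = F s"
  by (simp add: shift_op_def)

lemma shift_op_add: "shift_op (q + r) F s = shift_op q F s + shift_op r F s"
proof -
  let ?N = "Suc (max (Polynomial.degree q) (Polynomial.degree r))"
  have "Polynomial.degree (q + r) < ?N" "Polynomial.degree q < ?N" "Polynomial.degree r < ?N"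
    by (auto simp: degree_add_le less_Suc_eq_le)
  then show ?thesis
    by (simp only: shift_op_superset[of _ ?N] coeff_add distrib_right sum.distrib)
qed

lemma shift_op_smult: "shift_op (Polynomial.smult c q) F s = c * shift_op q F s"
  using degree_smult_le[of c q]
  by (simp add: shift_op_superset[of _ "Suc (Polynomial.degree q)"] sum_distrib_left mult.assoc less_Suc_eq_le
    del: sum.lessThan_Suc)

lemma shift_op_pCons: "shift_op (pCons c q) F s = c * F s + shift_op q F (Suc s)"
proof -
  have d: "Polynomial.degree (pCons c q) < Suc (Suc (Polynomial.degree q))"
    by (simp add: degree_pCons_le less_Suc_eq_le)
  show ?thesis
    unfolding shift_op_superset[OF d] shift_op_superset[OF lessI, of q F]
    by (subst sum.lessThan_Suc_shift) simp
qed

lemma shift_op_zero_poly: "shift_op 0 F s = 0"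
  by (simp add: shift_op_def)

lemma shift_op_zero_seq: "(\<And>s. F s = 0) \<Longrightarrow> shift_op q F s = 0"
  by (simp add: shift_op_def)

lemma shift_op_mult: "shift_op (q * r) F s = shift_op q (shift_op r F) s"
proof (induction q arbitrary: s)
  case 0
  then show ?case by (simp add: shift_op_zero_poly)
next
  case (pCons c q)
  then show ?case
    by (simp add: shift_op_pCons shift_op_add shift_op_smult)
qed

lemma shift_op_linear: "shift_op [:c, 1:] F s = c * F s + F (Suc s)"
  by (simp add: shift_op_pCons shift_op_zero_poly)

text \<open>
  The polynomial with roots \<open>- y\<^sub>j\<close>, so that its elementary symmetric coefficients carry no signs.
\<close>

definition root_poly :: "nat set \<Rightarrow> (nat \<Rightarrow> 'a::comm_ring_1) \<Rightarrow> 'a poly" where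
  "root_poly J y = (\<Prod>j\<in>J. [:y j, 1:])"

lemma root_poly_insert:
  "finite J \<Longrightarrow> j \<notin> J \<Longrightarrow> root_poly (insert j J) y = [:y j, 1:] * root_poly J y"
  unfolding root_poly_def by (rule prod.insert)

lemma root_poly_Un:
  "finite J \<Longrightarrow> finite K \<Longrightarrow> J \<inter> K = {} \<Longrightarrow> root_poly (J \<union> K) y = root_poly J y * root_poly K y"
  unfolding root_poly_def by (rule prod.union_disjoint)

lemma root_poly_monic:
  assumes "finite J"
  shows "Polynomial.coeff (root_poly J y) (card J) = 1 \<and> (\<forall>k>card J. Polynomial.coeff (root_poly J y) k = 0)"
  using assms
proof (induction J rule: finite_induct)
  case empty
  then show ?case by (simp add: root_poly_def)
next
  case (insert j J)
  have *: "Polynomial.coeff (root_poly (insert j J) y) (Suc k) =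
      y j * Polynomial.coeff (root_poly J y) (Suc k) + Polynomial.coeff (root_poly J y) k" for k
    using insert by (simp add: root_poly_insert)
  have "Polynomial.coeff (root_poly (insert j J) y) k = 0" if k: "k > card (insert j J)" for k
  proof -
    obtain l where "k = Suc l" "l > card J"
      using k insert(1,2) by (cases k) auto
    then show ?thesis using insert(3) by (simp add: *)
  qed
  then show ?case using insert * by simp
qed

lemma coeff_root_poly_card: "finite J \<Longrightarrow> Polynomial.coeff (root_poly J y) (card J) = 1"
  using root_poly_monic by blast

lemma coeff_root_poly_eq_0: "finite J \<Longrightarrow> k > card J \<Longrightarrow> Polynomial.coeff (root_poly J y) k = 0"
  using root_poly_monic by blast

lemma degree_root_poly_le: "finite J \<Longrightarrow> Polynomial.degree (root_poly J y) \<le> card J"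
  by (rule degree_le) (simp add: coeff_root_poly_eq_0)

definition hankel :: "nat \<Rightarrow> (nat \<Rightarrow> 'a) \<Rightarrow> (nat \<Rightarrow> nat) \<Rightarrow> 'a::comm_ring_1 mat" where
  "hankel n F a = mat n n (\<lambda>(i, l). F (a i + l))"

text \<open>
  The columns are the coefficient vectors of the Newton basis \<open>\<Prod>\<^sub>j\<^sub><\<^sub>l (w + y\<^sub>j)\<close>, \<open>l < n\<close>. In this
  basis of the polynomials modulo \<open>\<Prod>\<^sub>j\<^sub><\<^sub>n (w + y\<^sub>j)\<close> multiplication by \<open>w\<close> is bidiagonal.
\<close>

definition newton :: "nat \<Rightarrow> (nat \<Rightarrow> 'a) \<Rightarrow> 'a::comm_ring_1 mat" where
  "newton n y = mat n n (\<lambda>(k, l). Polynomial.coeff (root_poly {..<l} y) k)"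

lemma hankel_carrier: "hankel n F a \<in> carrier_mat n n"
  and newton_carrier: "newton n y \<in> carrier_mat n n"
  by (simp_all add: hankel_def newton_def)

lemma det_newton: "det (newton n y) = 1"
proof -
  have "det (newton n y) = prod_list (diag_mat (newton n y))"
    by (rule det_upper_triangular[of _ n])
       (auto simp: upper_triangular_def newton_def intro!: coeff_root_poly_eq_0)
  also have "\<dots> = (\<Prod>i<n. Polynomial.coeff (root_poly {..<i} y) i)"
    by (simp add: prod_list_diag_prod newton_def atLeast0LessThan)
  also have "\<dots> = 1"
    using coeff_root_poly_card[of "{..<i}" y for i] by (intro prod.neutral) simp
  finally show ?thesis .
qed

lemma mult_mat_index:
  assumes "A \<in> carrier_mat n n" "B \<in> carrier_mat n n" "i < n" "l < n"
  shows "(A * B) $$ (i, l) = (\<Sum>k<n. A $$ (i, k) * B $$ (k, l))"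
  using assms by (simp add: scalar_prod_def atLeast0LessThan)

lemma mult_newton_index:
  assumes "A \<in> carrier_mat n n" "i < n" "l < n" and A: "\<And>k. k < n \<Longrightarrow> A $$ (i, k) = G k"
  shows "(A * newton n y) $$ (i, l) = shift_op (root_poly {..<l} y) G 0"
proof -
  have "Polynomial.degree (root_poly {..<l} y) < n"
    using degree_root_poly_le[of "{..<l}" y] assms(3) by simp
  then have "shift_op (root_poly {..<l} y) G 0 =
      (\<Sum>k<n. Polynomial.coeff (root_poly {..<l} y) k * G k)"
    by (simp add: shift_op_superset)
  moreover have "(A * newton n y) $$ (i, l) = (\<Sum>k<n. A $$ (i, k) * Polynomial.coeff (root_poly {..<l} y) k)"
    using assms(1-3) by (simp add: newton_def scalar_prod_def atLeast0LessThan)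
  ultimately show ?thesis
    using A by (simp add: mult.commute)
qed

lemma shift_op_translate: "shift_op q (\<lambda>k. F (s + k)) 0 = shift_op q F s"
  by (simp add: shift_op_def)

text \<open>
  If \<open>F\<close> satisfies the recurrence with roots \<open>- y\<^sub>j\<close>, then advancing every row of its Hankel matrix
  by one step multiplies the matrix on the right by the companion matrix, whose eigenvalues are the
  \<open>- y\<^sub>j\<close>. Passing to the Newton basis makes the companion matrix triangular, so that the
  determinant can be read off over an arbitrary commutative ring.
\<close>

lemma det_hankel_shift:
  fixes F y :: "nat \<Rightarrow> 'a::comm_ring_1" and t :: 'a
  assumes rec: "\<And>s. shift_op (root_poly {..<n} y) F s = 0"
  shows "det (mat n n (\<lambda>(i, l). F (a i + l) - t * F (Suc (a i + l)))) =
    det (hankel n F a) * (\<Prod>j<n. 1 + t * y j)"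
proof -
  let ?A = "mat n n (\<lambda>(i, l). F (a i + l) - t * F (Suc (a i + l)))"
  let ?U = "newton n y"
  let ?b = "\<lambda>l s. shift_op (root_poly {..<l} y) F s"
  \<comment> \<open>the matrix of \<open>1 - t w\<close> in the Newton basis\<close>
  define W where "W = mat n n (\<lambda>(k, l). if k = l then 1 + t * y l else if k = Suc l then - t else 0)"
  have W: "W \<in> carrier_mat n n" by (simp add: W_def)
  have step: "?b l (Suc s) = ?b (Suc l) s - y l * ?b l s" for l s
  proof -
    have "root_poly {..<Suc l} y = [:y l, 1:] * root_poly {..<l} y"
      unfolding lessThan_Suc by (rule root_poly_insert) auto
    then have "?b (Suc l) s = y l * ?b l s + ?b l (Suc s)"
      by (simp only: shift_op_mult shift_op_linear)
    then show ?thesis by simp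
  qed
  have diff: "shift_op q (\<lambda>k. F (s + k) - t * F (Suc (s + k))) 0 = shift_op q F s - t * shift_op q F (Suc s)"
    for q s
    by (simp add: shift_op_def sum_subtractf sum_distrib_left algebra_simps)
  have B: "(hankel n F a * ?U) $$ (i, l) = ?b l (a i)" if "i < n" "l < n" for i l
    using mult_newton_index[OF hankel_carrier that, of F a "\<lambda>k. F (a i + k)" y] that
    by (simp add: hankel_def shift_op_translate)
  have "?A * ?U = (hankel n F a * ?U) * W"
  proof (rule eq_matI)
    show "dim_row (?A * ?U) = dim_row (hankel n F a * ?U * W)"
      "dim_col (?A * ?U) = dim_col (hankel n F a * ?U * W)"
      by (simp_all add: hankel_def newton_def W_def)
    fix i l assume "i < dim_row (hankel n F a * ?U * W)" "l < dim_col (hankel n F a * ?U * W)"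
    then have il: "i < n" "l < n" by (simp_all add: hankel_def W_def)
    have "(?A * ?U) $$ (i, l) = ?b l (a i) - t * ?b l (Suc (a i))"
      using mult_newton_index[of ?A n i l "\<lambda>k. F (a i + k) - t * F (Suc (a i + k))" y] il
      by (simp add: diff)
    also have "\<dots> = (1 + t * y l) * ?b l (a i) - t * ?b (Suc l) (a i)"
      unfolding step by (simp add: algebra_simps)
    also have "\<dots> = (\<Sum>k<n. ?b k (a i) * W $$ (k, l))"
    proof -
      have "(\<Sum>k<n. ?b k (a i) * W $$ (k, l)) =
        (\<Sum>k<n. (if k = l then ?b k (a i) * (1 + t * y l) else 0) + (if k = Suc l then ?b k (a i) * (- t) else 0))"
        using il by (intro sum.cong) (auto simp: W_def)
      also have "\<dots> = ?b l (a i) * (1 + t * y l) + (if Suc l < n then ?b (Suc l) (a i) * (- t) else 0)"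
        using il by (simp add: sum.distrib)
      also have "(if Suc l < n then ?b (Suc l) (a i) * (- t) else 0) = ?b (Suc l) (a i) * (- t)"
      proof (cases "Suc l < n")
        case False
        then have "Suc l = n" using il by simp
        then show ?thesis using rec by simp
      qed simp
      finally show ?thesis by (simp add: algebra_simps)
    qed
    also have "\<dots> = (hankel n F a * ?U * W) $$ (i, l)"
      unfolding mult_mat_index[OF mult_carrier_mat[OF hankel_carrier newton_carrier] W il]
      using il by (intro sum.cong refl) (simp only: B lessThan_iff)
    finally show "(?A * ?U) $$ (i, l) = (hankel n F a * ?U * W) $$ (i, l)" .
  qed
  then have "det ?A * det ?U = det (hankel n F a) * det ?U * det W"
    using det_mult[of ?A n ?U] det_mult[of "hankel n F a * ?U" n W] det_mult[of "hankel n F a" n ?U]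
      hankel_carrier[of n F a] newton_carrier[of n y] W by simp
  moreover have "det W = (\<Prod>j<n. 1 + t * y j)"
  proof -
    have "det W = prod_list (diag_mat W)"
      by (rule det_lower_triangular[OF _ W]) (auto simp: W_def)
    also have "\<dots> = (\<Prod>j<n. 1 + t * y j)"
      by (simp add: prod_list_diag_prod W_def atLeast0LessThan)
    finally show ?thesis .
  qed
  ultimately show ?thesis by (simp add: det_newton)
qed

text \<open>
  Multiplying from the left by the coefficients of \<open>\<Prod>\<^sub>j\<^sub>>\<^sub>i (w + y\<^sub>j)\<close> and from the right by those
  of \<open>\<Prod>\<^sub>j\<^sub><\<^sub>l (w + y\<^sub>j)\<close> applies the product of the two polynomials to \<open>F\<close>. For \<open>i < l\<close> this product
  is a multiple of the recurrence and gives \<open>0\<close>; on the diagonal just the factor \<open>w + y\<^sub>i\<close> is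
  missing. Both multipliers are unitriangular, the left one because the rows are listed with
  decreasing shifts \<open>n - 1 - i\<close>.
\<close>

lemma det_hankel_staircase:
  fixes F y :: "nat \<Rightarrow> 'a::comm_ring_1"
  assumes rec: "\<And>s. shift_op (root_poly {..<n} y) F s = 0"
  shows "det (hankel n F (\<lambda>i. n - 1 - i)) = (\<Prod>i<n. shift_op (root_poly ({..<n} - {i}) y) F 0)"
proof -
  let ?M = "hankel n F (\<lambda>i. n - 1 - i)"
  let ?U = "newton n y"
  let ?q = "\<lambda>i. root_poly {i<..<n} y"
  define L where "L = mat n n (\<lambda>(i, k). Polynomial.coeff (?q i) (n - 1 - k))"
  have L: "L \<in> carrier_mat n n" by (simp add: L_def)
  have MU: "?M * ?U \<in> carrier_mat n n"
    using hankel_carrier[of n F] newton_carrier[of n y] by (metis mult_carrier_mat)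
  have B: "(?M * ?U) $$ (k, l) = shift_op (root_poly {..<l} y) F (n - 1 - k)" if "k < n" "l < n" for k l
    using mult_newton_index[OF hankel_carrier that, of F "\<lambda>i. n - 1 - i" "\<lambda>j. F (n - 1 - k + j)" y] that
    unfolding shift_op_translate[of _ F] by (simp add: hankel_def)
  have entry: "(L * (?M * ?U)) $$ (i, l) = shift_op (?q i * root_poly {..<l} y) F 0"
    if il: "i < n" "l < n" for i l
  proof -
    have d: "Polynomial.degree (?q i) < n"
      using degree_root_poly_le[of "{i<..<n}" y] il by simp
    have "(L * (?M * ?U)) $$ (i, l) =
      (\<Sum>k<n. Polynomial.coeff (?q i) (n - 1 - k) * shift_op (root_poly {..<l} y) F (n - 1 - k))"
      unfolding mult_mat_index[OF L MU il]
    proof (intro sum.cong refl)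
      fix k assume "k \<in> {..<n}"
      then have k: "k < n" by simp
      then show "L $$ (i, k) * (?M * ?U) $$ (k, l) =
        Polynomial.coeff (?q i) (n - 1 - k) * shift_op (root_poly {..<l} y) F (n - 1 - k)"
        unfolding B[OF k il(2)] using il k by (simp add: L_def)
    qed
    also have "\<dots> = (\<Sum>k<n. Polynomial.coeff (?q i) k * shift_op (root_poly {..<l} y) F k)"
      by (rule sum.reindex_bij_witness[of _ "\<lambda>k. n - 1 - k" "\<lambda>k. n - 1 - k"]) auto
    also have "\<dots> = shift_op (?q i * root_poly {..<l} y) F 0"
      by (simp add: shift_op_mult shift_op_superset[OF d])
    finally show ?thesis .
  qed
  have tri: "(L * (?M * ?U)) $$ (i, l) = 0" if il: "i < l" "l < n" for i l
  proof -
    have "{i<..<n} = {i<..<l} \<union> {l..<n}" "{..<n} = {..<l} \<union> {l..<n}" using il by auto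
    then have "?q i * root_poly {..<l} y = root_poly {i<..<l} y * root_poly {..<n} y"
      by (simp add: root_poly_Un[of "{i<..<l}" "{l..<n}"] root_poly_Un[of "{..<l}" "{l..<n}"]
        disjoint_iff mult_ac)
    then show ?thesis
      using il entry[of i l] by (simp add: shift_op_mult shift_op_zero_seq[of "shift_op (root_poly {..<n} y) F"] rec)
  qed
  have diag: "(L * (?M * ?U)) $$ (i, i) = shift_op (root_poly ({..<n} - {i}) y) F 0" if "i < n" for i
  proof -
    have "{..<n} - {i} = {i<..<n} \<union> {..<i}" using that by auto
    then have "root_poly ({..<n} - {i}) y = ?q i * root_poly {..<i} y"
      by (simp add: root_poly_Un disjoint_iff)
    then show ?thesis using entry[OF that that] by simp
  qed
  have "det (L * (?M * ?U)) = prod_list (diag_mat (L * (?M * ?U)))"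
    by (rule det_lower_triangular[OF tri mult_carrier_mat[OF L MU]])
  also have "\<dots> = (\<Prod>i<n. shift_op (root_poly ({..<n} - {i}) y) F 0)"
    using L diag by (simp add: prod_list_diag_prod atLeast0LessThan del: index_mult_mat(1) assoc_mult_mat)
  finally have "det (L * (?M * ?U)) = \<dots>" .
  moreover have "det (L * (?M * ?U)) = det L * (det ?M * det ?U)"
    using det_mult[OF L MU] det_mult[of ?M n ?U] hankel_carrier[of n F] newton_carrier[of n y] by simp
  moreover have "det L = 1"
  proof -
    have "det L = prod_list (diag_mat L)"
      by (rule det_upper_triangular[OF _ L])
         (auto simp: upper_triangular_def L_def intro!: coeff_root_poly_eq_0)
    also have "\<dots> = (\<Prod>i<n. Polynomial.coeff (?q i) (n - 1 - i))"
      by (simp add: prod_list_diag_prod L_def atLeast0LessThan)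
    also have "\<dots> = 1"
      using coeff_root_poly_card[of "{i<..<n}" y for i] by (intro prod.neutral) simp
    finally show ?thesis .
  qed
  ultimately show ?thesis by (simp add: det_newton)
qed

lemma shift_op_fps_const:
  assumes "finite J"
  shows "shift_op (root_poly J (\<lambda>j. fps_const (y j))) (\<lambda>s. fps_const (F s)) s =
    fps_const (shift_op (root_poly J y) F s)"
  using assms
proof (induction J arbitrary: s rule: finite_induct)
  case empty
  then show ?case by (simp add: root_poly_def)
next
  case (insert j J)
  show ?case
    unfolding root_poly_insert[OF insert(1,2)] shift_op_mult shift_op_linear insert(3) by simp
qed

text \<open>
  The coefficient of \<open>t\<^sup>k\<close> in \<open>det_hankel_shift\<close>, with \<open>t\<close> the variable of a power series ring over
  the given ring. On the side of the matrix, multilinearity chooses the set \<open>S\<close> of rows that are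
  advanced. The consequence of interest: the span of the Hankel determinants is closed under
  multiplication by the elementary symmetric polynomials in the \<open>y\<^sub>j\<close>.
\<close>

lemma det_hankel_times_elem:
  fixes F y :: "nat \<Rightarrow> 'a::comm_ring_1"
  assumes rec: "\<And>s. shift_op (root_poly {..<n} y) F s = 0"
  shows "det (hankel n F a) * fps_nth (\<Prod>j<n. 1 + fps_const (y j) * fps_X) k =
    (\<Sum>S | S \<subseteq> {..<n} \<and> card S = k. (-1) ^ k * det (hankel n F (\<lambda>i. a i + (if i \<in> S then 1 else 0))))"
proof -
  let ?F = "\<lambda>s. fps_const (F s)"
  let ?P = "{\<pi>. \<pi> permutes {0..<n}}"
  let ?G = "\<lambda>S \<pi>. \<Prod>i<n. F (a i + (if i \<in> S then 1 else 0) + \<pi> i)"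
  have finP: "finite ?P" by (rule finite_permutations) simp
  have "det (hankel n ?F a) = fps_const (det (hankel n F a))"
  proof -
    interpret c: comm_ring_hom "fps_const :: 'a \<Rightarrow> 'a fps"
      by unfold_locales auto
    have "hankel n ?F a = map_mat fps_const (hankel n F a)"
      by (rule eq_matI) (auto simp: hankel_def)
    then show ?thesis by (metis c.hom_det)
  qed
  moreover have "det (mat n n (\<lambda>(i, l). ?F (a i + l) - fps_X * ?F (Suc (a i + l)))) =
      det (hankel n ?F a) * (\<Prod>j<n. 1 + fps_X * fps_const (y j))"
    by (rule det_hankel_shift) (simp add: shift_op_fps_const rec)
  ultimately have "det (hankel n F a) * fps_nth (\<Prod>j<n. 1 + fps_const (y j) * fps_X) k =
      fps_nth (det (mat n n (\<lambda>(i, l). ?F (a i + l) - fps_X * ?F (Suc (a i + l))))) k"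
    by (simp add: mult.commute[of fps_X])
  also have "det (mat n n (\<lambda>(i, l). ?F (a i + l) - fps_X * ?F (Suc (a i + l)))) =
      (\<Sum>\<pi>\<in>?P. signof \<pi> * (\<Prod>i<n. - (fps_X * ?F (Suc (a i + \<pi> i))) + ?F (a i + \<pi> i)))"
    unfolding det_def'[of "mat n n f" n for f, simplified] atLeast0LessThan[symmetric]
    by (intro sum.cong refl arg_cong2[where f = "(*)"] prod.cong) (auto dest: permutes_in_image)
  also have "\<dots> = (\<Sum>\<pi>\<in>?P. \<Sum>S\<in>Pow {..<n}. signof \<pi> * ((- fps_X) ^ card S * fps_const (?G S \<pi>)))"
  proof (intro sum.cong refl)
    fix \<pi> assume "\<pi> \<in> ?P"
    have "(\<Prod>i\<in>S. - (fps_X * ?F (Suc (a i + \<pi> i)))) * (\<Prod>i\<in>{..<n} - S. ?F (a i + \<pi> i)) =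
        (- fps_X) ^ card S * fps_const (?G S \<pi>)" if S: "S \<in> Pow {..<n}" for S
    proof -
      have fc: "fps_const (\<Prod>i\<in>A. f i) = (\<Prod>i\<in>A. fps_const (f i))" for A and f :: "nat \<Rightarrow> 'a"
        by (induction A rule: infinite_finite_induct) (simp_all flip: fps_const_mult)
      have "finite S" using S by (auto intro: finite_subset)
      have "fps_const (?G S \<pi>) = (\<Prod>i<n. ?F (a i + (if i \<in> S then 1 else 0) + \<pi> i))"
        by (rule fc)
      also have "\<dots> = (\<Prod>i\<in>{..<n} - S. ?F (a i + (if i \<in> S then 1 else 0) + \<pi> i)) *
          (\<Prod>i\<in>S. ?F (a i + (if i \<in> S then 1 else 0) + \<pi> i))"
        using S by (intro prod.subset_diff) auto
      also have "\<dots> = (\<Prod>i\<in>{..<n} - S. ?F (a i + \<pi> i)) * (\<Prod>i\<in>S. ?F (Suc (a i + \<pi> i)))"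
        by (intro arg_cong2[where f = "(*)"] prod.cong) auto
      finally have G: "fps_const (?G S \<pi>) = \<dots>" .
      have "(\<Prod>i\<in>S. - (fps_X * ?F (Suc (a i + \<pi> i)))) = (- fps_X) ^ card S * (\<Prod>i\<in>S. ?F (Suc (a i + \<pi> i)))"
        by (simp add: prod.distrib flip: mult_minus_left)
      then show ?thesis by (simp only: G mult_ac)
    qed
    then show "signof \<pi> * (\<Prod>i<n. - (fps_X * ?F (Suc (a i + \<pi> i))) + ?F (a i + \<pi> i)) =
        (\<Sum>S\<in>Pow {..<n}. signof \<pi> * ((- fps_X) ^ card S * fps_const (?G S \<pi>)))"
      by (subst prod_add) (simp_all add: sum_distrib_left)
  qed
  also have "\<dots> = (\<Sum>S\<in>Pow {..<n}. (- fps_X) ^ card S *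
      fps_const (det (hankel n F (\<lambda>i. a i + (if i \<in> S then 1 else 0)))))"
  proof (subst sum.swap, intro sum.cong refl)
    fix S
    have s: "signof \<pi> = (fps_const (signof \<pi>) :: 'a fps)" for \<pi> :: "nat \<Rightarrow> nat"
      by (simp add: sign_def flip: fps_const_neg)
    have "det (hankel n F (\<lambda>i. a i + (if i \<in> S then 1 else 0))) = (\<Sum>\<pi>\<in>?P. signof \<pi> * ?G S \<pi>)"
      unfolding det_def'[OF hankel_carrier] atLeast0LessThan[symmetric]
      by (intro sum.cong refl arg_cong2[where f = "(*)"] prod.cong)
         (auto simp: hankel_def dest: permutes_in_image)
    moreover have fs: "fps_const (\<Sum>i\<in>A. f i) = (\<Sum>i\<in>A. fps_const (f i))" for A and f :: "(nat \<Rightarrow> nat) \<Rightarrow> 'a"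
      by (induction A rule: infinite_finite_induct) (simp_all flip: fps_const_add)
    ultimately show "(\<Sum>\<pi>\<in>?P. signof \<pi> * ((- fps_X) ^ card S * fps_const (?G S \<pi>))) =
        (- fps_X) ^ card S * fps_const (det (hankel n F (\<lambda>i. a i + (if i \<in> S then 1 else 0))))"
      unfolding s by (simp add: sum_distrib_left mult.left_commute flip: fps_const_mult)
  qed
  also have "fps_nth \<dots> k = (\<Sum>S\<in>Pow {..<n}. if card S = k then
      (-1) ^ k * det (hankel n F (\<lambda>i. a i + (if i \<in> S then 1 else 0))) else 0)"
  proof -
    have "fps_nth ((- fps_X) ^ c * fps_const d) k = (if c = k then (-1) ^ k * d else 0)" for c and d :: 'a
    proof -
      have "(- fps_X) ^ c * fps_const d = fps_const ((-1) ^ c * d) * fps_X ^ c"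
        by (subst power_minus) (simp add: mult_ac flip: fps_const_mult fps_const_power fps_const_neg fps_const_1_eq_1)
      then show ?thesis by (simp add: fps_X_power_iff)
    qed
    then show ?thesis by (simp add: fps_sum_nth)
  qed
  also have "\<dots> = (\<Sum>S\<in>{S\<in>Pow {..<n}. card S = k}.
      (-1) ^ k * det (hankel n F (\<lambda>i. a i + (if i \<in> S then 1 else 0))))"
    by (subst sum.inter_filter) auto
  also have "{S\<in>Pow {..<n}. card S = k} = {S. S \<subseteq> {..<n} \<and> card S = k}" by auto
  finally show ?thesis .
qed

text \<open>
  Since \<open>(1 + y X)\<close> cancels \<open>geo y\<close>, the operator \<open>w + y\<close> removes one factor \<open>X geo y\<close> from a power
  series, read as the sequence of its coefficients from some index on.
\<close>

lemma shift_op_geo: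
  assumes "finite J"
  shows "shift_op (root_poly J y) (\<lambda>s. fps_nth (fps_X ^ card J * G * (\<Prod>j\<in>J. geo (y j))) (d + s)) s =
    fps_nth G (d + s)"
  using assms
proof (induction J arbitrary: G s rule: finite_induct)
  case empty
  then show ?case by (simp add: root_poly_def)
next
  case (insert j J)
  have "fps_X ^ card (insert j J) * G * (\<Prod>j\<in>insert j J. geo (y j)) =
      fps_X ^ card J * (fps_X * G * geo (y j)) * (\<Prod>j\<in>J. geo (y j))"
    using insert(1,2) by (simp add: mult_ac)
  then have "shift_op (root_poly (insert j J) y)
      (\<lambda>s. fps_nth (fps_X ^ card (insert j J) * G * (\<Prod>j\<in>insert j J. geo (y j))) (d + s)) s =
    y j * fps_nth (fps_X * G * geo (y j)) (d + s) + fps_nth (fps_X * G * geo (y j)) (Suc (d + s))"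
    unfolding root_poly_insert[OF insert(1,2)] shift_op_mult shift_op_linear
    by (simp only: insert(3) add_Suc_right)
  also have "\<dots> = fps_nth ((1 + fps_const (y j) * fps_X) * (fps_X * G * geo (y j))) (Suc (d + s))"
    unfolding linear_fps_nth by (simp add: add.commute)
  also have "(1 + fps_const (y j) * fps_X) * (fps_X * G * geo (y j)) =
      fps_X * G * ((1 + fps_const (y j) * fps_X) * geo (y j))"
    by (simp only: mult_ac)
  finally show ?case by (simp add: linear_fps_geo)
qed

section \<open>Polynomials symmetric in several blocks of variables\<close>

text \<open>
  \<open>f\<close> has leading coefficient 1 and leading monomial \<open>\<alpha>\<close> in the lexicographic order, in which the
  variable of smallest index counts most.
\<close>

definition lead_monic :: "'k::field mpoly \<Rightarrow> (nat \<Rightarrow>\<^sub>0 nat) \<Rightarrow> bool" where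
  "lead_monic f \<alpha> \<longleftrightarrow> Poly_Mapping.lookup f \<alpha> = 1 \<and> (\<forall>\<beta>\<in>Poly_Mapping.keys f. \<beta> \<le> \<alpha>)"

lemma lead_monic_1: "lead_monic 1 0"
  by (auto simp: lead_monic_def lookup_one)

lemma lead_monic_mult:
  assumes f: "lead_monic f \<alpha>" and g: "lead_monic g \<beta>"
  shows "lead_monic (f * g) (\<alpha> + \<beta>)"
proof -
  define f' where "f' = f - Poly_Mapping.single \<alpha> 1"
  define g' where "g' = g - Poly_Mapping.single \<beta> 1"
  have f': "\<gamma> < \<alpha>" if "\<gamma> \<in> Poly_Mapping.keys f'" for \<gamma>
    using that f by (cases "\<gamma> = \<alpha>")
      (auto simp: f'_def lead_monic_def in_keys_iff lookup_minus lookup_single order_less_le)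
  have g': "\<gamma> < \<beta>" if "\<gamma> \<in> Poly_Mapping.keys g'" for \<gamma>
    using that g by (cases "\<gamma> = \<beta>")
      (auto simp: g'_def lead_monic_def in_keys_iff lookup_minus lookup_single order_less_le)
  have le: "\<gamma> \<le> \<alpha> + \<beta>" if "\<gamma> \<in> Poly_Mapping.keys (f * g)" for \<gamma>
    using that keys_mult[of f g] f g by (auto simp: lead_monic_def intro!: add_mono)
  have "f * g = Poly_Mapping.single (\<alpha> + \<beta>) 1 + (Poly_Mapping.single \<alpha> 1 * g' + f' * g)"
    by (simp add: f'_def g'_def algebra_simps mult_single)
  moreover have "\<alpha> + \<beta> \<notin> Poly_Mapping.keys (Poly_Mapping.single \<alpha> 1 * g')"
    using keys_mult[of "Poly_Mapping.single \<alpha> (1::'a)" g'] g' by fastforce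
  moreover have "\<alpha> + \<beta> \<notin> Poly_Mapping.keys (f' * g)"
  proof
    assume "\<alpha> + \<beta> \<in> Poly_Mapping.keys (f' * g)"
    then obtain a b where "a \<in> Poly_Mapping.keys f'" "b \<in> Poly_Mapping.keys g" "\<alpha> + \<beta> = a + b"
      using keys_mult[of f' g] by auto
    moreover have "a + b < \<alpha> + \<beta>"
      using f'[OF calculation(1)] g calculation(2) by (auto simp: lead_monic_def intro: add_less_le_mono)
    ultimately show False by simp
  qed
  ultimately have "Poly_Mapping.lookup (f * g) (\<alpha> + \<beta>) = 1"
    by (simp add: lookup_add in_keys_iff)
  then show ?thesis using le by (simp add: lead_monic_def)
qed

lemma lead_monic_prod: "(\<And>i. i \<in> I \<Longrightarrow> lead_monic (g i) (a i)) \<Longrightarrow> lead_monic (prod g I) (sum a I)"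
  by (induction I rule: infinite_finite_induct) (simp_all add: lead_monic_1 lead_monic_mult)

definition exponents :: "nat set \<Rightarrow> (nat \<Rightarrow> nat) \<Rightarrow> (nat \<Rightarrow>\<^sub>0 nat)" where
  "exponents V a = (\<Sum>v\<in>V. Poly_Mapping.single v (a v))"

lemma lookup_exponents:
  "finite V \<Longrightarrow> Poly_Mapping.lookup (exponents V a) i = (if i \<in> V then a i else 0)"
  by (simp add: exponents_def lookup_sum lookup_single when_def)

lemma power_var: "var w ^ k = Poly_Mapping.single (Poly_Mapping.single w k) (1::'k::field)"
  by (induction k) (simp_all add: var_def mult_single single_add[symmetric])

lemma prod_power_var_eq:
  "finite S \<Longrightarrow> (\<Prod>v\<in>S. var v ^ a v) = Poly_Mapping.single (exponents S a) (1::'k::field)"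
  by (induction S rule: finite_induct) (simp_all add: exponents_def power_var mult_single)

text \<open>
  The Frobenius map is additive, so the \<open>p\<close>-th power may be taken in each term.
\<close>

lemma frobenius_elem_sym:
  assumes p: "CHAR('k::field) = p" "prime p" and V: "finite V"
  shows "(elem_sym V i :: 'k mpoly) ^ p =
    (\<Sum>S | S \<subseteq> V \<and> card S = i. Poly_Mapping.single (exponents S (\<lambda>_. p)) 1)"
proof -
  have q: "prime CHAR('k mpoly)" "p = CHAR('k mpoly)" using p by (simp_all add: CHAR_mpoly)
  have "(elem_sym V i :: 'k mpoly) ^ p = (\<Sum>S | S \<subseteq> V \<and> card S = i. \<Prod>v\<in>S. var v ^ p)"
    unfolding elem_sym_def q(2) by (subst freshmans_dream_sum[OF q(1) refl]) (simp add: prod_power_distrib)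
  also have "\<dots> = (\<Sum>S | S \<subseteq> V \<and> card S = i. Poly_Mapping.single (exponents S (\<lambda>_. p)) 1)"
    using V by (intro sum.cong refl prod_power_var_eq) (auto intro: finite_subset)
  finally show ?thesis .
qed

lemma less_monomial_iff:
  "\<alpha> < \<beta> \<longleftrightarrow> (\<exists>k. Poly_Mapping.lookup \<alpha> k < Poly_Mapping.lookup \<beta> k \<and>
    (\<forall>l<k. Poly_Mapping.lookup \<alpha> l = Poly_Mapping.lookup \<beta> l))" for \<alpha> \<beta> :: "nat \<Rightarrow>\<^sub>0 nat"
  by (simp add: less_poly_mapping.rep_eq less_fun_def)

text \<open>
  Among the products of a given number of distinct variables, the one over an initial segment of
  \<open>V\<close> is lexicographically largest.
\<close>

lemma lead_monic_elem_sym: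
  assumes V: "finite V" "U \<subseteq> V" and seg: "\<And>u v. u \<in> U \<Longrightarrow> v \<in> V - U \<Longrightarrow> u < v"
  shows "lead_monic (elem_sym V (card U) :: 'k::field mpoly) (exponents U (\<lambda>_. 1))"
proof -
  let ?S = "{S. S \<subseteq> V \<and> card S = card U}"
  let ?e = "\<lambda>S. exponents S (\<lambda>_. 1)"
  have finS: "finite S" if "S \<subseteq> V" for S using that V by (auto intro: finite_subset)
  have finU: "finite U" using finS V by simp
  have fin: "finite ?S" using V by auto
  have lt: "?e S < ?e U" if S: "S \<subseteq> V" "card S = card U" "S \<noteq> U" for S
  proof -
    let ?D = "(S - U) \<union> (U - S)"
    have D: "finite ?D" "?D \<noteq> {}" using S finS finU by auto
    \<comment> \<open>the first variable in which the two monomials differ; as \<open>S\<close> and \<open>U\<close> have the same size,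
      it must belong to the initial segment \<open>U\<close>\<close>
    let ?k = "Min ?D"
    have k: "?k \<in> ?D" using Min_in[OF D] .
    have kle: "?k \<le> w" if "w \<in> ?D" for w using that D by simp
    have "?k \<in> U - S"
    proof (rule ccontr)
      assume "?k \<notin> U - S"
      then have kS: "?k \<in> S - U" using k by blast
      have "\<not> U \<subseteq> S"
        using S card_subset_eq[of S U] finS by auto
      then obtain w where "w \<in> U - S" by auto
      then show False using seg[of w ?k] kS S(1) kle[of w] by auto
    qed
    moreover have "l \<in> S \<longleftrightarrow> l \<in> U" if "l < ?k" for l
      using that kle[of l] by auto
    ultimately show ?thesis
      unfolding less_monomial_iff using finS[OF S(1)] finU
      by (intro exI[of _ ?k]) (auto simp: lookup_exponents)
  qed
  have e: "elem_sym V (card U) = (\<Sum>S\<in>?S. Poly_Mapping.single (?e S) (1::'k))"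
    unfolding elem_sym_def using finS prod_power_var_eq[of _ "\<lambda>_. 1", where 'k = 'k]
    by (intro sum.cong refl) simp
  have "Poly_Mapping.lookup (elem_sym V (card U) :: 'k mpoly) (?e U) = (\<Sum>S\<in>?S. if S = U then 1 else (0::'k))"
    unfolding e lookup_sum lookup_single
  proof (intro sum.cong refl)
    fix S assume "S \<in> ?S"
    then show "((1::'k) when ?e S = ?e U) = (if S = U then 1 else 0)"
      using lt[of S] by (cases "S = U") auto
  qed
  also have "\<dots> = 1" using fin V by simp
  finally have 1: "Poly_Mapping.lookup (elem_sym V (card U)) (?e U) = (1::'k)" .
  have "\<beta> \<le> ?e U" if "\<beta> \<in> Poly_Mapping.keys (elem_sym V (card U) :: 'k mpoly)" for \<beta>
  proof -
    have "\<exists>S\<in>?S. \<beta> = ?e S"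
      using that keys_sum[of "\<lambda>S. Poly_Mapping.single (?e S) (1::'k)" ?S] unfolding e
      by auto
    then obtain S where "S \<in> ?S" "\<beta> = ?e S" by blast
    then show ?thesis using lt[of S] by (cases "S = U") auto
  qed
  then show ?thesis using 1 by (auto simp: lead_monic_def)
qed

lemma lead_monic_power_elem_sym:
  assumes "finite V" "U \<subseteq> V" "\<And>u v. u \<in> U \<Longrightarrow> v \<in> V - U \<Longrightarrow> u < v"
  shows "lead_monic (elem_sym V (card U) ^ q) (exponents U (\<lambda>_. q))"
proof (induction q)
  case 0
  then show ?case by (simp add: exponents_def lead_monic_1)
next
  case (Suc q)
  have "exponents U (\<lambda>_. Suc q) = exponents U (\<lambda>_. 1) + exponents U (\<lambda>_. q)"
    by (simp add: exponents_def sum.distrib[symmetric] single_add[symmetric])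
  then show ?case using lead_monic_mult[OF lead_monic_elem_sym[OF assms] Suc] by simp
qed

text \<open>
  A decreasing exponent sequence with entries divisible by \<open>q\<close> is the leading monomial of a product
  of \<open>q\<close>-th powers of elementary symmetric polynomials: strip off one factor \<open>\<sigma>\<^sub>i\<^sup>q\<close>, where \<open>i\<close> is the
  number of nonzero exponents.
\<close>

lemma lead_monic_block:
  assumes V: "finite V" and q: "q > 0"
    and anti: "\<And>u v. u \<in> V \<Longrightarrow> v \<in> V \<Longrightarrow> u < v \<Longrightarrow> a v \<le> a u" and dvd: "\<And>v. v \<in> V \<Longrightarrow> q dvd a v"
  shows "\<exists>g\<in>alg (range (\<lambda>i. elem_sym V i ^ q)). lead_monic (g :: 'k::field mpoly) (exponents V a)"
  using anti dvd
proof (induction "\<Sum>v\<in>V. a v" arbitrary: a rule: less_induct)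
  case less
  let ?G = "alg (range (\<lambda>i. elem_sym V i ^ q)) :: 'k mpoly set"
  have G: "subalgebra ?G" by (rule algebra_generated_subalgebra)
  show ?case
  proof (cases "\<forall>v\<in>V. a v = 0")
    case True
    then have "exponents V a = 0" by (simp add: exponents_def)
    then show ?thesis using lead_monic_1 subalgebraD(3)[OF G] by auto
  next
    case False
    define U where "U = {v \<in> V. a v > 0}"
    define b where "b v = a v - q" for v
    have U: "U \<subseteq> V" "U \<noteq> {}" using False by (auto simp: U_def)
    have seg: "u < v" if "u \<in> U" "v \<in> V - U" for u v
      using that less.prems(1)[of v u] by (cases u v rule: linorder_cases) (auto simp: U_def)
    have q_le: "q \<le> a v" if "v \<in> U" for v
      using that less.prems(2)[of v] by (auto simp: U_def intro: dvd_imp_le)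
    have "(\<Sum>v\<in>V. b v) < (\<Sum>v\<in>V. a v)"
    proof (rule sum_strict_mono_ex1[OF V])
      show "\<exists>v\<in>V. b v < a v" using U q q_le unfolding b_def U_def by fastforce
    qed (simp add: b_def)
    moreover have "b v \<le> b u" if "u \<in> V" "v \<in> V" "u < v" for u v
      using less.prems(1)[OF that] by (simp add: b_def)
    moreover have "q dvd b v" if "v \<in> V" for v
      using less.prems(2)[OF that] by (simp add: b_def dvd_diff_nat)
    ultimately obtain g where g: "g \<in> ?G" "lead_monic g (exponents V b)"
      using less.hyps[of b] by blast
    have "exponents V a = exponents U (\<lambda>_. q) + exponents V b"
    proof (rule poly_mapping_eqI)
      fix k
      show "Poly_Mapping.lookup (exponents V a) k =
        Poly_Mapping.lookup (exponents U (\<lambda>_. q) + exponents V b) k"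
        using V finite_subset[OF U(1) V] q_le[of k] U(1)
        by (auto simp: lookup_add lookup_exponents b_def U_def)
    qed
    moreover have "elem_sym V (card U) ^ q \<in> ?G" by (rule algebra_generated_inc) simp
    ultimately show ?thesis
      using lead_monic_mult[OF lead_monic_power_elem_sym[OF V U(1) seg, of q] g(2)] subalgebraD(6)[OF G _ g(1)] by metis
  qed
qed

text \<open>
  The lexicographic order is a well-order only when the number of variables is bounded, hence the
  restriction to variables of index at most \<open>N\<close>; then exponent vectors are lists of fixed length.
\<close>

lemma wf_monomials:
  "wf {(\<alpha>, \<beta> :: nat \<Rightarrow>\<^sub>0 nat). Poly_Mapping.keys \<beta> \<subseteq> {..N} \<and> \<alpha> < \<beta>}"
proof (rule wf_subset)
  let ?l = "\<lambda>\<alpha>. map (Poly_Mapping.lookup \<alpha>) [0..<Suc N] :: nat list"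
  show "wf (inv_image (lexn less_than (Suc N)) ?l)"
    by (intro wf_inv_image wf_lexn wf_less_than)
  show "{(\<alpha>, \<beta>). Poly_Mapping.keys \<beta> \<subseteq> {..N} \<and> \<alpha> < \<beta>} \<subseteq> inv_image (lexn less_than (Suc N)) ?l"
  proof clarify
    fix \<alpha> \<beta> :: "nat \<Rightarrow>\<^sub>0 nat"
    assume \<beta>: "Poly_Mapping.keys \<beta> \<subseteq> {..N}" and "\<alpha> < \<beta>"
    then obtain k where k: "Poly_Mapping.lookup \<alpha> k < Poly_Mapping.lookup \<beta> k"
      "\<And>l. l < k \<Longrightarrow> Poly_Mapping.lookup \<alpha> l = Poly_Mapping.lookup \<beta> l"
      by (auto simp: less_monomial_iff)
    have "k \<in> Poly_Mapping.keys \<beta>" using k(1) by (simp add: in_keys_iff)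
    then have "k < Suc N" using \<beta> by auto
    then have "[0..<Suc N] = [0..<k] @ k # [Suc k..<Suc N]"
      by (metis upt_add_eq_append upt_conv_Cons le_add_diff_inverse less_imp_le_nat zero_le)
    then have s: "?l \<gamma> = map (Poly_Mapping.lookup \<gamma>) [0..<k] @ Poly_Mapping.lookup \<gamma> k #
        map (Poly_Mapping.lookup \<gamma>) [Suc k..<Suc N]" for \<gamma>
      by (metis list.map(2) map_append)
    have "map (Poly_Mapping.lookup \<alpha>) [0..<k] = map (Poly_Mapping.lookup \<beta>) [0..<k]"
      using k(2) by simp
    then have "(?l \<alpha>, ?l \<beta>) \<in> lexn less_than (Suc N)"
      unfolding lexn_conv mem_Collect_eq case_prod_conv using s[of \<alpha>] s[of \<beta>] k(1)
      by (metis diff_zero length_map length_upt less_than_iff)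
    then show "(\<alpha>, \<beta>) \<in> inv_image (lexn less_than (Suc N)) ?l" by simp
  qed
qed

lemma subst_involution_single:
  assumes \<pi>: "\<And>i. \<pi> (\<pi> i) = i"
  shows "subst (\<lambda>i. var (\<pi> i)) (Poly_Mapping.single \<alpha> c) =
    Poly_Mapping.single (Poly_Mapping.map_key \<pi> \<alpha>) c"
proof -
  have inj: "inj \<pi>" by (metis \<pi> injI)
  have k: "Poly_Mapping.keys (Poly_Mapping.map_key \<pi> \<alpha>) = \<pi> ` Poly_Mapping.keys \<alpha>"
    unfolding keys_map_key[OF inj] using \<pi> by (auto simp: image_iff) metis
  have "Poly_Mapping.single (Poly_Mapping.map_key \<pi> \<alpha>) c =
      const c * (\<Prod>i\<in>\<pi> ` Poly_Mapping.keys \<alpha>. var i ^ Poly_Mapping.lookup (Poly_Mapping.map_key \<pi> \<alpha>) i)"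
    unfolding monomial_eq_prod_vars[of "Poly_Mapping.map_key \<pi> \<alpha>"] k ..
  also have "\<dots> = const c * (\<Prod>i\<in>Poly_Mapping.keys \<alpha>. var (\<pi> i) ^ Poly_Mapping.lookup \<alpha> i)"
    by (subst prod.reindex) (use inj in \<open>auto simp: map_key.rep_eq[OF inj] \<pi> intro: inj_on_subset\<close>)
  finally show ?thesis by (simp add: substitute_single[OF rhom_const])
qed

lemma lookup_subst_involution:
  assumes \<pi>: "\<And>i. \<pi> (\<pi> i) = i"
  shows "Poly_Mapping.lookup (subst (\<lambda>i. var (\<pi> i)) f) (Poly_Mapping.map_key \<pi> \<beta>) =
    Poly_Mapping.lookup f \<beta>"
proof -
  have injp: "inj \<pi>" by (metis \<pi> injI)
  have "Poly_Mapping.map_key \<pi> (Poly_Mapping.map_key \<pi> \<gamma>) = \<gamma>" for \<gamma> :: "nat \<Rightarrow>\<^sub>0 nat"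
    by (rule poly_mapping_eqI) (simp add: map_key.rep_eq[OF injp] \<pi>)
  then have inj: "Poly_Mapping.map_key \<pi> \<alpha> = Poly_Mapping.map_key \<pi> \<beta> \<longleftrightarrow> \<alpha> = \<beta>"
    for \<alpha> \<beta> :: "nat \<Rightarrow>\<^sub>0 nat"
    by metis
  have "subst (\<lambda>i. var (\<pi> i)) f = (\<Sum>\<alpha>\<in>Poly_Mapping.keys f.
      Poly_Mapping.single (Poly_Mapping.map_key \<pi> \<alpha>) (Poly_Mapping.lookup f \<alpha>))"
    by (subst monomial_sum[of f])
       (simp only: substitute_sum[OF rhom_const] subst_involution_single[of \<pi>, OF \<pi>])
  then show ?thesis
    by (simp add: lookup_sum lookup_single inj when_def in_keys_iff sum.delta)
qed

abbreviation swap :: "nat \<Rightarrow> nat \<Rightarrow> 'k::field mpoly \<Rightarrow> 'k mpoly" where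
  "swap i j \<equiv> subst (\<lambda>l. var (transpose i j l))"

text \<open>
  If the leading monomial had the larger exponent at \<open>b\<close>, exchanging the two variables would give
  a larger monomial of \<open>f\<close>.
\<close>

lemma Max_keys_antimono:
  assumes sym: "swap a b f = f" and ab: "a < b" and f: "f \<noteq> 0"
  shows "Poly_Mapping.lookup (Max (Poly_Mapping.keys f)) b \<le> Poly_Mapping.lookup (Max (Poly_Mapping.keys f)) a"
proof (rule ccontr)
  let ?\<alpha> = "Max (Poly_Mapping.keys f)"
  let ?\<beta> = "Poly_Mapping.map_key (transpose a b) ?\<alpha>"
  assume less: "\<not> ?thesis"
  have \<alpha>: "?\<alpha> \<in> Poly_Mapping.keys f" using f by (intro Max_in) auto
  have "?\<beta> \<in> Poly_Mapping.keys f"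
    using \<alpha> lookup_subst_involution[of "transpose a b" f ?\<alpha>] sym by (simp add: in_keys_iff)
  then have le: "?\<beta> \<le> ?\<alpha>" by simp
  have "Poly_Mapping.lookup ?\<beta> l = Poly_Mapping.lookup ?\<alpha> (transpose a b l)" for l
    by (simp add: map_key.rep_eq)
  then have "?\<alpha> < ?\<beta>"
    unfolding less_monomial_iff using less ab
    by (intro exI[of _ a]) (auto simp: transpose_def)
  then show False using le by simp
qed

definition exps_dvd :: "nat \<Rightarrow> nat \<Rightarrow> 'k::field mpoly set" where
  "exps_dvd q v = {f. \<forall>\<alpha>\<in>Poly_Mapping.keys f. q dvd Poly_Mapping.lookup \<alpha> v}"

lemma subalgebra_exps_dvd: "subalgebra (exps_dvd q v)"
proof (rule subalgebraI)
  show "const c \<in> exps_dvd q v" for c by (simp add: exps_dvd_def const_def)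
next
  fix f g :: "'a mpoly" assume fg: "f \<in> exps_dvd q v" "g \<in> exps_dvd q v"
  show "f + g \<in> exps_dvd q v"
    using fg keys_add[of f g] by (auto simp: exps_dvd_def)
  show "f * g \<in> exps_dvd q v"
    using fg keys_mult[of f g] by (force simp: exps_dvd_def lookup_add)
qed

lemma var_in_exps_dvd: "w \<noteq> v \<or> q = 1 \<Longrightarrow> var w \<in> exps_dvd q v"
  by (auto simp: exps_dvd_def var_def lookup_single)

lemma elem_sym_in_subalgebra: "subalgebra S \<Longrightarrow> (\<And>v. v \<in> V \<Longrightarrow> var v \<in> S) \<Longrightarrow> elem_sym V i \<in> S"
  unfolding elem_sym_def by (intro subalgebra_sum subalgebra_prod) auto

lemma power_elem_sym_in_exps_dvd:
  assumes q: "q = 1 \<or> q = CHAR('k) \<and> prime q" and V: "finite V"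
  shows "(elem_sym V i :: 'k::field mpoly) ^ q \<in> exps_dvd q v"
proof (cases "q = 1")
  case True
  then show ?thesis
    by (intro subalgebra_power elem_sym_in_subalgebra subalgebra_exps_dvd var_in_exps_dvd) auto
next
  case False
  then have "(elem_sym V i :: 'k mpoly) ^ q =
      (\<Sum>S | S \<subseteq> V \<and> card S = i. Poly_Mapping.single (exponents S (\<lambda>_. q)) 1)"
    using q V by (intro frobenius_elem_sym) auto
  moreover have "Poly_Mapping.single (exponents S (\<lambda>_. q)) 1 \<in> (exps_dvd q v :: 'k mpoly set)" if "S \<subseteq> V" for S
    using finite_subset[OF that V] by (auto simp: exps_dvd_def lookup_exponents)
  ultimately show ?thesis
    by (auto intro: subalgebra_sum[OF subalgebra_exps_dvd])
qed

lemma elem_sym_permute: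
  assumes "finite V" "\<pi> permutes V"
  shows "subst (\<lambda>i. var (\<pi> i)) (elem_sym V k) = (elem_sym V k :: 'k::field mpoly)"
proof -
  have "subst (\<lambda>i. var (\<pi> i)) (elem_sym V k :: 'k mpoly) = fps_nth (E_fps V (\<lambda>v. var (\<pi> v))) k"
    using rhom_elem_sym[OF rhom_subst assms(1)] by (simp add: subst_simps)
  also have "\<dots> = elem_sym V k"
    using E_fps_reindex[OF permutes_imp_bij[OF assms(2)], of "var :: nat \<Rightarrow> 'k mpoly"] assms(1)
    by (simp add: elem_sym_eq_E_fps)
  finally show ?thesis .
qed

lemma subst_elem_sym_fixed:
  "finite V \<Longrightarrow> (\<And>v. v \<in> V \<Longrightarrow> \<sigma> v = var v) \<Longrightarrow> subst \<sigma> (elem_sym V k) = elem_sym V k"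
  using rhom_elem_sym[OF rhom_subst, of V \<sigma> k] E_fps_cong[of V \<sigma> var]
  by (simp add: subst_simps elem_sym_eq_E_fps)

text \<open>
  The fundamental theorem for polynomials symmetric in several disjoint blocks of variables, where
  in addition all exponents in some of the blocks may be multiples of the characteristic. Gauss's
  argument applies: the leading monomial of \<open>f\<close> is decreasing on each block, so it is also
  the leading monomial of a product of the proposed generators, and subtracting a multiple of that
  product lowers it. The exponent \<open>q i\<close> must be 1 or the characteristic for the generators
  \<open>\<sigma>\<^sub>k\<^sup>q\<close> themselves to have exponents divisible by \<open>q\<close>.
\<close>

lemma multisymmetric_fundamental:
  fixes f :: "'k::field mpoly" and V :: "'i \<Rightarrow> nat set"
  assumes I: "finite I" "\<And>i. i \<in> I \<Longrightarrow> finite (V i)"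
    and disj: "\<And>i j. i \<in> I \<Longrightarrow> j \<in> I \<Longrightarrow> i \<noteq> j \<Longrightarrow> V i \<inter> V j = {}"
    and q: "\<And>i. i \<in> I \<Longrightarrow> q i = 1 \<or> q i = CHAR('k) \<and> prime (q i)"
    and f: "f \<in> polys_in (\<Union>i\<in>I. V i)"
    and dvd: "\<And>i v. i \<in> I \<Longrightarrow> v \<in> V i \<Longrightarrow> f \<in> exps_dvd (q i) v"
    and sym: "\<And>i a b. i \<in> I \<Longrightarrow> a \<in> V i \<Longrightarrow> b \<in> V i \<Longrightarrow> swap a b f = f"
  shows "f \<in> alg (\<Union>i\<in>I. range (\<lambda>k. elem_sym (V i) k ^ q i))"
proof -
  define G :: "'k mpoly set" where "G = alg (\<Union>i\<in>I. range (\<lambda>k. elem_sym (V i) k ^ q i))"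
  define P where "P = {f :: 'k mpoly. f \<in> polys_in (\<Union>i\<in>I. V i) \<and>
    (\<forall>i\<in>I. \<forall>v\<in>V i. f \<in> exps_dvd (q i) v) \<and>
    (\<forall>i\<in>I. \<forall>a\<in>V i. \<forall>b\<in>V i. swap a b f = f)}"
  have G: "subalgebra G" unfolding G_def by (rule algebra_generated_subalgebra)
  have P: "subalgebra P"
    by (rule subalgebraI)
       (auto simp: P_def subst_simps subalgebraD[OF subalgebra_polys_in] subalgebraD[OF subalgebra_exps_dvd])
  have "G \<subseteq> P"
    unfolding G_def
  proof (rule algebra_generated_minimal[OF P], clarify)
    fix i k assume i: "i \<in> I"
    have "elem_sym (V i) k ^ q i \<in> polys_in (\<Union>i\<in>I. V i)"
      using i by (intro subalgebra_power elem_sym_in_subalgebra subalgebra_polys_in var_in_polys_in) auto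
    moreover have "elem_sym (V i) k ^ q i \<in> (exps_dvd (q j) v :: 'k mpoly set)" if "j \<in> I" "v \<in> V j" for j v
    proof (cases "i = j")
      case True
      then show ?thesis using power_elem_sym_in_exps_dvd q[OF i] I(2)[OF i] by blast
    next
      case False
      then show ?thesis
        using disj[OF i that(1)] that(2)
        by (intro subalgebra_power elem_sym_in_subalgebra subalgebra_exps_dvd var_in_exps_dvd) auto
    qed
    moreover have "swap a b (elem_sym (V i) k ^ q i) = (elem_sym (V i) k ^ q i :: 'k mpoly)"
      if "j \<in> I" "a \<in> V j" "b \<in> V j" for j a b
    proof (cases "i = j")
      case True
      then show ?thesis
        using elem_sym_permute[OF I(2)[OF i] permutes_swap_id[of a "V i" b], where 'k = 'k] that
        by (simp add: subst_simps)
    next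
      case False
      then have "transpose a b v = v" if "v \<in> V i" for v
        using disj[OF i \<open>j \<in> I\<close>] that \<open>a \<in> V j\<close> \<open>b \<in> V j\<close> by (auto simp: transpose_def)
      then show ?thesis
        using subst_elem_sym_fixed[OF I(2)[OF i], of "\<lambda>l. var (transpose a b l) :: 'k mpoly" k]
        by (simp add: subst_simps)
    qed
    ultimately show "elem_sym (V i) k ^ q i \<in> P" by (auto simp: P_def)
  qed
  obtain N where N: "(\<Union>i\<in>I. V i) \<subseteq> {..N}"
    using I finite_nat_iff_bounded_le[of "\<Union>i\<in>I. V i"] by auto
  have main: "f \<in> G" if "f \<in> P" "f \<noteq> 0" "\<alpha> = Max (Poly_Mapping.keys f)" for f \<alpha>
    using that
  proof (induction \<alpha> arbitrary: f rule: wf_induct_rule[OF wf_monomials[of N]])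
    case (1 \<alpha>)
    let ?a = "Poly_Mapping.lookup \<alpha>"
    have \<alpha>: "\<alpha> \<in> Poly_Mapping.keys f" and max: "\<And>\<beta>. \<beta> \<in> Poly_Mapping.keys f \<Longrightarrow> \<beta> \<le> \<alpha>"
      using 1 by (auto intro!: Max_in)
    have sub: "Poly_Mapping.keys \<alpha> \<subseteq> (\<Union>i\<in>I. V i)"
      using \<alpha> 1(2) by (auto simp: P_def polys_in_def)
    have "\<exists>g\<in>alg (range (\<lambda>k. elem_sym (V i) k ^ q i)). lead_monic (g::'k mpoly) (exponents (V i) ?a)" if i: "i \<in> I" for i
    proof (rule lead_monic_block)
      show "finite (V i)" "q i > 0" using I i q[OF i] by (auto dest: prime_gt_0_nat)
      show "?a v \<le> ?a u" if "u \<in> V i" "v \<in> V i" "u < v" for u v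
        using 1(2-4) that i Max_keys_antimono[of u v f] by (auto simp: P_def)
      show "q i dvd ?a v" if "v \<in> V i" for v
        using 1(2) \<alpha> that i by (auto simp: P_def exps_dvd_def)
    qed
    then obtain g where g: "\<And>i. i \<in> I \<Longrightarrow> g i \<in> alg (range (\<lambda>k. elem_sym (V i) k ^ q i))"
      "\<And>i. i \<in> I \<Longrightarrow> lead_monic (g i :: 'k mpoly) (exponents (V i) ?a)"
      by metis
    define h where "h = prod g I"
    have "g i \<in> G" if "i \<in> I" for i
    proof -
      have "alg (range (\<lambda>k. elem_sym (V i) k ^ q i)) \<subseteq> G"
        using that by (intro algebra_generated_minimal[OF G]) (auto simp: G_def intro: algebra_generated_inc)
      then show ?thesis using g(1)[OF that] by blast
    qed
    then have hG: "h \<in> G" unfolding h_def by (rule subalgebra_prod[OF G])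
    have "\<alpha> = (\<Sum>i\<in>I. exponents (V i) ?a)"
    proof (rule poly_mapping_eqI)
      fix k
      have "(\<Sum>i\<in>I. Poly_Mapping.lookup (exponents (V i) ?a) k) = (\<Sum>i\<in>I. if k \<in> V i then ?a k else 0)"
        using I by (intro sum.cong) (simp_all add: lookup_exponents)
      also have "\<dots> = ?a k"
      proof (cases "\<exists>i\<in>I. k \<in> V i")
        case True
        then obtain i where i: "i \<in> I" "k \<in> V i" by auto
        then have "(\<Sum>i\<in>I. if k \<in> V i then ?a k else 0) = (\<Sum>j\<in>I. if j = i then ?a k else 0)"
          using disj by (intro sum.cong) auto
        then show ?thesis using i I by simp
      next
        case False
        then have "k \<notin> Poly_Mapping.keys \<alpha>" using sub by auto
        then show ?thesis using False by (simp add: in_keys_iff)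
      qed
      finally show "?a k = Poly_Mapping.lookup (\<Sum>i\<in>I. exponents (V i) ?a) k"
        by (simp add: lookup_sum)
    qed
    then have lth: "lead_monic h \<alpha>" using lead_monic_prod[of I g, OF g(2)] by (simp add: h_def)
    let ?c = "Poly_Mapping.lookup f \<alpha>"
    define f' where "f' = f - const ?c * h"
    have lk: "Poly_Mapping.lookup f' \<beta> = Poly_Mapping.lookup f \<beta> - ?c * Poly_Mapping.lookup h \<beta>" for \<beta>
      unfolding f'_def const_def mult_map_scale_conv_mult[symmetric] by (simp add: lookup_minus map.rep_eq when_def)
    have less: "\<beta> < \<alpha>" if "\<beta> \<in> Poly_Mapping.keys f'" for \<beta>
    proof -
      have "\<beta> \<noteq> \<alpha>" using that lth by (auto simp: in_keys_iff lk lead_monic_def)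
      moreover have "\<beta> \<in> Poly_Mapping.keys f \<or> \<beta> \<in> Poly_Mapping.keys h"
        using that by (auto simp: in_keys_iff lk)
      ultimately show ?thesis using max lth by (auto simp: lead_monic_def order_less_le)
    qed
    have f'P: "f' \<in> P" unfolding f'_def
      using 1(2) hG \<open>G \<subseteq> P\<close> by (auto intro!: subalgebraD[OF P])
    have "f' \<in> G"
    proof (cases "f' = 0")
      case False
      have "Max (Poly_Mapping.keys f') \<in> Poly_Mapping.keys f'" using False by (intro Max_in) auto
      then show ?thesis
        using 1(1)[of "Max (Poly_Mapping.keys f')" f'] f'P False less sub N by auto
    qed (simp add: subalgebraD[OF G])
    then have "f' + const ?c * h \<in> G" using hG by (intro subalgebraD[OF G])
    then show ?case by (simp add: f'_def)
  qed
  have "f \<in> P" using f dvd sym by (auto simp: P_def)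
  then show ?thesis using main[OF _ _ refl, of f] subalgebraD(2)[OF G] unfolding G_def by (cases "f = 0") auto
qed

section \<open>Multiples of the resultant\<close>

definition resultant_xy :: "nat set \<Rightarrow> nat set \<Rightarrow> 'k::field mpoly" where
  "resultant_xy X Y = (\<Prod>x\<in>X. \<Prod>y\<in>Y. var x - var y)"

text \<open>
  For a single \<open>y = b\<close> the element \<open>c\<^sub>m(X|b)\<close>, \<open>m\<close> being the size of \<open>X\<close>, is the resultant, and from there on the
  sequence is geometric. The case \<open>a = 0\<close> supplies the diagonal entries in the determinant formula for the
  resultant.
\<close>

lemma E_fps_geo_nth:
  "finite X \<Longrightarrow> fps_nth (E_fps X \<sigma> * geo b) (card X + a) = (- b) ^ a * (\<Prod>x\<in>X. \<sigma> x - b)"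
proof (induction X arbitrary: a rule: finite_induct)
  case empty
  then show ?case by simp
next
  case (insert x X)
  have "fps_nth (E_fps (insert x X) \<sigma> * geo b) (card (insert x X) + a) =
      fps_nth ((1 + fps_const (\<sigma> x) * fps_X) * (E_fps X \<sigma> * geo b)) (Suc (card X + a))"
    using insert(1,2) by (simp add: E_fps_insert mult.assoc)
  also have "\<dots> = fps_nth (E_fps X \<sigma> * geo b) (card X + Suc a) + \<sigma> x * fps_nth (E_fps X \<sigma> * geo b) (card X + a)"
    unfolding linear_fps_nth by simp
  also have "\<dots> = (- b) ^ a * (\<Prod>x\<in>insert x X. \<sigma> x - b)"
    unfolding insert(3) using insert(1,2) by (simp add: algebra_simps)
  finally show ?case .
qed

text \<open>
  Since \<open>C \<Prod> (1 + y\<^sub>j X) = \<Prod> (1 + x\<^sub>i X)\<close> has degree \<open>m\<close> (the size of \<open>X\<close>), the \<open>c\<^sub>r\<close>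
  satisfy the recurrence with roots \<open>- y\<^sub>j\<close> from index \<open>m - n + 1\<close> on. Their Hankel determinants
  lie in the algebra of the \<open>c\<^sub>r\<close>, one of them is the resultant (\<open>det_hankel_staircase\<close>), and
  their span is closed under multiplication by the \<open>\<sigma>\<^sub>k(Y)\<close> (\<open>det_hankel_times_elem\<close>). The
  \<open>\<sigma>\<^sub>k(X)\<close> need no separate treatment because \<open>\<sigma>\<^sub>k(X) = \<Sum> c\<^sub>i \<sigma>\<^sub>k\<^sub>-\<^sub>i(Y)\<close>.
\<close>

lemma resultant_multiple_in_alg_C:
  fixes u :: "'k::field mpoly"
  assumes X: "finite X" and Y: "finite Y"
    and u: "u \<in> alg (range (elem_sym X) \<union> range (elem_sym Y))"
  shows "resultant_xy X Y * u \<in> alg (range (fps_nth (C_fps X Y var)))"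
proof -
  define A :: "'k mpoly set" where "A = alg (range (fps_nth (C_fps X Y var)))"
  have A: "subalgebra A" unfolding A_def by (rule algebra_generated_subalgebra)
  have C: "fps_nth (C_fps X Y var) r \<in> A" for r
    unfolding A_def by (rule algebra_generated_inc) simp
  define n where "n = card Y"
  define m where "m = card X"
  obtain e where e: "bij_betw e {..<n} Y"
    using ex_bij_betw_nat_finite[OF Y] unfolding n_def atLeast0LessThan by auto
  let ?y = "\<lambda>j. var (e j) :: 'k mpoly"
  have H: "H_fps Y var = (\<Prod>j<n. geo (?y j))"
    unfolding H_fps_def by (rule prod.reindex_bij_betw[OF e, symmetric])
  have EY: "E_fps Y var = (\<Prod>j<n. 1 + fps_const (?y j) * fps_X)"
    unfolding E_fps_def by (rule prod.reindex_bij_betw[OF e, symmetric])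
  \<comment> \<open>\<open>F s = c\<^sub>r\<close> for \<open>r = m - n + 1 + s\<close>; the factor \<open>X\<^sup>n\<close> makes this 0 when \<open>r\<close> is negative\<close>
  define F where "F s = fps_nth (fps_X ^ n * E_fps X var * (\<Prod>j<n. geo (?y j))) (Suc m + s)" for s
  have F: "F s \<in> A" for s
    using C subalgebraD(2)[OF A]
    by (simp add: F_def mult.assoc fps_X_power_mult_nth C_fps_def H flip: H)
  have rec: "shift_op (root_poly {..<n} ?y) F s = 0" for s
  proof -
    have "shift_op (root_poly {..<n} ?y) F s = fps_nth (E_fps X var) (Suc m + s)"
      using shift_op_geo[of "{..<n}" ?y "E_fps X var" "Suc m" s] unfolding F_def by simp
    then show ?thesis using X by (simp add: E_fps_nth_eq_0 m_def)
  qed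
  have stair: "det (hankel n F (\<lambda>i. n - 1 - i)) = resultant_xy X Y"
  proof -
    have "shift_op (root_poly ({..<n} - {i}) ?y) F 0 = (\<Prod>x\<in>X. var x - ?y i)" if i: "i < n" for i
    proof -
      have n: "card ({..<n} - {i}) = n - 1" using i by simp
      have g: "(\<Prod>j<n. geo (?y j)) = geo (?y i) * (\<Prod>j\<in>{..<n} - {i}. geo (?y j))"
        using i by (intro prod.remove) auto
      have x: "fps_X ^ n = (fps_X ^ (n - 1) * fps_X :: 'k mpoly fps)"
        using i by (cases n) (simp_all add: mult.commute)
      have "fps_X ^ n * E_fps X var * (\<Prod>j<n. geo (?y j)) =
          fps_X ^ (n - 1) * (fps_X * E_fps X var * geo (?y i)) * (\<Prod>j\<in>{..<n} - {i}. geo (?y j))"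
        unfolding g x by (simp only: mult_ac)
      then have "F = (\<lambda>s. fps_nth (fps_X ^ (n - 1) * (fps_X * E_fps X var * geo (?y i)) *
          (\<Prod>j\<in>{..<n} - {i}. geo (?y j))) (Suc m + s))"
        by (intro ext) (simp only: F_def)
      then have "shift_op (root_poly ({..<n} - {i}) ?y) F 0 =
          fps_nth (fps_X * E_fps X var * geo (?y i)) (Suc m)"
        using shift_op_geo[of "{..<n} - {i}" ?y "fps_X * E_fps X var * geo (?y i)" "Suc m" 0]
        unfolding n by simp
      also have "\<dots> = (\<Prod>x\<in>X. var x - ?y i)"
        using E_fps_geo_nth[OF X, of var "?y i" 0] by (simp add: mult.assoc m_def)
      finally show ?thesis .
    qed
    then have "det (hankel n F (\<lambda>i. n - 1 - i)) = (\<Prod>i<n. \<Prod>x\<in>X. var x - ?y i)"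
      unfolding det_hankel_staircase[OF rec] by simp
    also have "\<dots> = (\<Prod>y\<in>Y. \<Prod>x\<in>X. var x - var y)"
      by (rule prod.reindex_bij_betw[OF e])
    also have "\<dots> = resultant_xy X Y"
      unfolding resultant_xy_def by (rule prod.swap)
    finally show ?thesis .
  qed
  have sgn: "signof \<pi> \<in> A" for \<pi> :: "nat \<Rightarrow> nat"
    using subalgebraD(3,7)[OF A] by (auto simp: sign_def)
  have det: "det (hankel n F a) \<in> A" for a
    unfolding det_def'[OF hankel_carrier]
    by (intro subalgebra_sum[OF A] subalgebraD(6)[OF A] subalgebra_prod[OF A] sgn)
       (auto simp: hankel_def F dest: permutes_in_image)
  \<comment> \<open>multipliers of all Hankel determinants into \<open>A\<close>, and the elements that preserve them\<close>
  define M where "M = {u. \<forall>a. u * det (hankel n F a) \<in> A}"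
  define W where "W = {w. \<forall>u\<in>M. w * u \<in> M}"
  have W: "subalgebra W"
  proof (rule subalgebraI)
    show "const c \<in> W" for c
      by (auto simp: W_def M_def mult.assoc intro: subalgebraD[OF A])
    show "f + g \<in> W" if "f \<in> W" "g \<in> W" for f g
      using that by (auto simp: W_def M_def distrib_right intro: subalgebraD[OF A])
    show "f * g \<in> W" if "f \<in> W" "g \<in> W" for f g
      using that unfolding W_def by (simp add: mult.assoc)
  qed
  have AW: "A \<subseteq> W"
    by (auto simp: W_def M_def mult.assoc intro: subalgebraD[OF A])
  have EYW: "fps_nth (E_fps Y var) k \<in> W" for k
    unfolding W_def M_def
  proof clarify
    fix u a assume u: "\<forall>a. u * det (hankel n F a) \<in> A"
    have "fps_nth (E_fps Y var) k * u * det (hankel n F a) =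
        u * (det (hankel n F a) * fps_nth (\<Prod>j<n. 1 + fps_const (?y j) * fps_X) k)"
      by (simp add: EY mult_ac)
    also have "\<dots> = (\<Sum>S | S \<subseteq> {..<n} \<and> card S = k.
        (-1) ^ k * (u * det (hankel n F (\<lambda>i. a i + (if i \<in> S then 1 else 0)))))"
      unfolding det_hankel_times_elem[OF rec] by (simp add: sum_distrib_left mult_ac)
    also have "\<dots> \<in> A"
    proof (intro subalgebra_sum[OF A])
      show "(-1) ^ k * (u * det (hankel n F (\<lambda>i. a i + (if i \<in> S then 1 else 0)))) \<in> A" for S
        using u by (intro subalgebraD(6)[OF A _ u[rule_format]] subalgebra_power[OF A]
          subalgebraD(7)[OF A] subalgebraD(3)[OF A])
    qed
    finally show "fps_nth (E_fps Y var) k * u * det (hankel n F a) \<in> A" .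
  qed
  have EXW: "fps_nth (E_fps X var) k \<in> W" for k
  proof -
    have "E_fps X var = C_fps X Y var * (E_fps Y var :: 'k mpoly fps)"
      using E_fps_H_fps[of Y "var :: nat \<Rightarrow> 'k mpoly"] by (simp add: C_fps_def mult.assoc mult.commute[of "H_fps Y var"])
    then have "fps_nth (E_fps X var) k = (\<Sum>i=0..k. fps_nth (C_fps X Y var) i * (fps_nth (E_fps Y var) (k - i) :: 'k mpoly))"
      by (simp add: fps_mult_nth)
    also have "\<dots> \<in> W"
      using AW C EYW by (intro subalgebra_sum[OF W] subalgebraD(6)[OF W]) auto
    finally show ?thesis .
  qed
  have "alg (range (elem_sym X) \<union> range (elem_sym Y)) \<subseteq> W"
    using EXW EYW by (intro algebra_generated_minimal[OF W]) (auto simp: elem_sym_eq_E_fps X Y)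
  then have "u \<in> W" using u by blast
  moreover have "1 \<in> M" using det by (simp add: M_def)
  ultimately have "u * 1 \<in> M" unfolding W_def by blast
  then have "u * det (hankel n F (\<lambda>i. n - 1 - i)) \<in> A" by (simp add: M_def)
  then show ?thesis unfolding stair A_def by (simp only: mult.commute)
qed

section \<open>Supersymmetry of the generators\<close>

lemma rhom_subst_x1_y1: "rhom (subst_x1_y1 m)"
  unfolding subst_x1_y1_def by (rule rhom_substitute[OF rhom_const_poly])

lemma subalgebra_A_s: "subalgebra (A_s m n)"
proof (rule subalgebraI)
  show "const c \<in> A_s m n" for c
    by (simp add: A_s_def xy_polys_polys_in symmetric_in_def subst_simps subalgebraD(1)[OF subalgebra_polys_in]
      subst_x1_y1_def substitute_const[OF rhom_const_poly])
  fix f g :: "'a mpoly"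
  assume "f \<in> A_s m n" "g \<in> A_s m n"
  then show "f + g \<in> A_s m n" "f * g \<in> A_s m n"
    by (auto simp: A_s_def xy_polys_polys_in symmetric_in_def subst_simps rhomD[OF rhom_subst_x1_y1]
      pderiv_add pderiv_mult intro: subalgebraD[OF subalgebra_polys_in])
qed

lemma subst_c_gen_fixed:
  assumes "\<And>i. i \<in> {1..m + n} \<Longrightarrow> \<sigma> i = (var i :: 'k::field mpoly)"
  shows "subst \<sigma> (c_gen m n r) = c_gen m n r"
proof -
  have "C_fps {1..m} {m + 1..m + n} \<sigma> = C_fps {1..m} {m + 1..m + n} (var :: nat \<Rightarrow> 'k mpoly)"
    unfolding C_fps_def using assms by (intro arg_cong2[where f = "(*)"] E_fps_cong H_fps_cong) auto
  then show ?thesis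
    using rhom_c_gen[OF rhom_subst[of \<sigma>], of m n r] by (simp add: subst_simps c_gen_eq_C_fps)
qed

text \<open>
  Under \<open>x\<^sub>1 = y\<^sub>1 = T\<close> the factors \<open>1 + T X\<close> of the generating function cancel, so the result is
  free of \<open>T\<close>.
\<close>

lemma c_gen_in_A_s:
  assumes "m \<ge> 1" "n \<ge> 1"
  shows "(c_gen m n r :: 'k::field mpoly) \<in> A_s m n"
proof -
  let ?X = "{1..m}" and ?Y = "{m + 1..m + n}" and ?v = "var :: nat \<Rightarrow> 'k mpoly"
  have "subst (\<lambda>i. if i \<in> {1..m + n} then ?v i else 0) (c_gen m n r) \<in> polys_in {1..m + n}"
    by (rule subst_in_subalgebra[OF subalgebra_polys_in _ polys_in_UNIV])
       (auto intro: var_in_polys_in subalgebraD(2)[OF subalgebra_polys_in])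
  then have "(c_gen m n r :: 'k mpoly) \<in> polys_in {1..m + n}"
    by (subst (asm) subst_c_gen_fixed) auto
  moreover have "symmetric_in ?X (c_gen m n r :: 'k mpoly)"
    unfolding symmetric_in_def
  proof clarify
    fix \<pi> assume \<pi>: "\<pi> permutes ?X"
    have "E_fps ?X (\<lambda>i. ?v (\<pi> i)) = E_fps ?X ?v"
      by (rule E_fps_reindex[OF permutes_imp_bij[OF \<pi>]])
    moreover have "H_fps ?Y (\<lambda>i. ?v (\<pi> i)) = H_fps ?Y ?v"
      by (rule H_fps_cong) (use permutes_not_in[OF \<pi>] in auto)
    ultimately show "subst (\<lambda>i. ?v (\<pi> i)) (c_gen m n r) = c_gen m n r"
      using rhom_c_gen[OF rhom_subst[of "\<lambda>i. ?v (\<pi> i)"], of m n r]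
      by (simp add: subst_simps c_gen_eq_C_fps C_fps_def)
  qed
  moreover have "symmetric_in ?Y (c_gen m n r :: 'k mpoly)"
    unfolding symmetric_in_def
  proof clarify
    fix \<pi> assume \<pi>: "\<pi> permutes ?Y"
    have "H_fps ?Y (\<lambda>i. ?v (\<pi> i)) = H_fps ?Y ?v"
      by (rule H_fps_reindex[OF permutes_imp_bij[OF \<pi>]])
    moreover have "E_fps ?X (\<lambda>i. ?v (\<pi> i)) = E_fps ?X ?v"
      by (rule E_fps_cong) (use permutes_not_in[OF \<pi>] in auto)
    ultimately show "subst (\<lambda>i. ?v (\<pi> i)) (c_gen m n r) = c_gen m n r"
      using rhom_c_gen[OF rhom_subst[of "\<lambda>i. ?v (\<pi> i)"], of m n r]
      by (simp add: subst_simps c_gen_eq_C_fps C_fps_def)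
  qed
  moreover have "pderiv (subst_x1_y1 m (c_gen m n r :: 'k mpoly)) = 0"
  proof -
    let ?\<tau> = "\<lambda>i. if i = 1 \<or> i = m + 1 then [:0, 1:] else [:?v i:]"
    let ?X' = "{2..m}" and ?Y' = "{m + 2..m + n}"
    have v: "subst_x1_y1 m (?v i) = ?\<tau> i" for i
      by (simp add: subst_x1_y1_def substitute_var[OF rhom_const_poly])
    have X: "?X = insert 1 ?X'" and Y: "?Y = insert (m + 1) ?Y'" using assms by auto
    have "E_fps ?X ?\<tau> = (1 + fps_const [:0, 1:] * fps_X) * E_fps ?X' ?\<tau>"
      unfolding X by (subst E_fps_insert) auto
    moreover have "H_fps ?Y ?\<tau> = geo [:0, 1:] * H_fps ?Y' ?\<tau>"
      unfolding Y by (subst H_fps_insert) auto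
    ultimately have "C_fps ?X ?Y ?\<tau> =
        ((1 + fps_const [:0, 1:] * fps_X) * geo [:0, 1:]) * (E_fps ?X' ?\<tau> * H_fps ?Y' ?\<tau>)"
      unfolding C_fps_def by (simp only: mult_ac)
    also have "\<dots> = E_fps ?X' (\<lambda>i. [:?v i:]) * H_fps ?Y' (\<lambda>i. [:?v i:])"
      unfolding linear_fps_geo mult_1_left
      by (intro arg_cong2[where f = "(*)"] E_fps_cong H_fps_cong) auto
    also have "\<dots> = fps_map (\<lambda>c. [:c:]) (C_fps ?X' ?Y' ?v)"
      unfolding C_fps_def[symmetric] fps_map_C_fps[OF rhom_coeff_lift] ..
    finally have "subst_x1_y1 m (c_gen m n r :: 'k mpoly) = [:fps_nth (C_fps ?X' ?Y' ?v) r:]"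
      unfolding rhom_c_gen[OF rhom_subst_x1_y1] v by simp
    then show ?thesis by simp
  qed
  ultimately show ?thesis by (simp add: A_s_def xy_polys_polys_in)
qed

lemma A_s_p_subset_A_s: "A_s_p p m n \<subseteq> A_s m n"
  unfolding A_s_p_def by (rule algebra_generated_minimal[OF subalgebra_A_s]) auto

text \<open>
  All exponents are 0 or \<open>p\<close>, and the derivative of a \<open>p\<close>-th power vanishes.
\<close>

lemma power_elem_sym_in_A_s_p:
  assumes p: "CHAR('k::field) = p" "prime p"
  shows "(elem_sym {m + 1..m + n} j :: 'k mpoly) ^ p \<in> A_s_p p m n"
proof -
  let ?Y = "{m + 1..m + n}"
  let ?f = "(elem_sym ?Y j :: 'k mpoly) ^ p"
  have p0: "p > 0" using p(2) by (rule prime_gt_0_nat)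
  have "?f \<in> polys_in {1..m + n}"
    by (intro subalgebra_power elem_sym_in_subalgebra subalgebra_polys_in var_in_polys_in) auto
  moreover have "symmetric_in {1..m} ?f"
    unfolding symmetric_in_def
  proof clarify
    fix \<pi> assume \<pi>: "\<pi> permutes {1..m}"
    have "subst (\<lambda>i. var (\<pi> i)) (elem_sym ?Y j) = (elem_sym ?Y j :: 'k mpoly)"
      by (rule subst_elem_sym_fixed) (use permutes_not_in[OF \<pi>] in auto)
    then show "subst (\<lambda>i. var (\<pi> i)) ?f = ?f" by (simp add: subst_simps)
  qed
  moreover have "symmetric_in ?Y ?f"
    unfolding symmetric_in_def by (simp add: subst_simps elem_sym_permute)
  moreover have "pderiv (subst_x1_y1 m ?f) = 0"
  proof -
    have "of_nat p = (0 :: 'k mpoly)" using p CHAR_mpoly[where 'k = 'k] of_nat_CHAR[where 'a = "'k mpoly"] by simp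
    then show ?thesis by (simp add: rhom_power[OF rhom_subst_x1_y1] pderiv_power)
  qed
  moreover have "p_balanced p m n ?f"
  proof -
    have key: "\<exists>S. S \<subseteq> ?Y \<and> card S = j \<and> \<alpha> = exponents S (\<lambda>_. p)" if "\<alpha> \<in> Poly_Mapping.keys ?f" for \<alpha>
    proof -
      have "\<alpha> \<in> (\<Union>S\<in>{S. S \<subseteq> ?Y \<and> card S = j}.
          Poly_Mapping.keys (Poly_Mapping.single (exponents S (\<lambda>_. p)) (1::'k)))"
        using that keys_sum[of "\<lambda>S. Poly_Mapping.single (exponents S (\<lambda>_. p)) (1::'k)"]
        unfolding frobenius_elem_sym[OF p finite_atLeastAtMost] by (rule subsetD[rotated])
      then show ?thesis by auto
    qed
    have "(\<Sum>i\<in>Poly_Mapping.keys \<alpha>. Poly_Mapping.lookup \<alpha> i) = j * p" if \<alpha>: "\<alpha> \<in> Poly_Mapping.keys ?f" for \<alpha>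
    proof -
      obtain S where S: "S \<subseteq> ?Y" "card S = j" "\<alpha> = exponents S (\<lambda>_. p)" using key[OF \<alpha>] by blast
      have fin: "finite S" using S(1) by (rule finite_subset) simp
      have "Poly_Mapping.keys \<alpha> = S"
        using p0 by (auto simp: in_keys_iff S(3) lookup_exponents[OF fin] split: if_splits)
      then show ?thesis by (simp add: S(2,3) lookup_exponents[OF fin])
    qed
    then have "homogeneous ?f" unfolding homogeneous_def by blast
    moreover have "p dvd Poly_Mapping.lookup \<alpha> i" if \<alpha>: "\<alpha> \<in> Poly_Mapping.keys ?f" for \<alpha> i
      using key[OF \<alpha>] by (auto simp: lookup_exponents finite_subset[OF _ finite_atLeastAtMost])
    ultimately show ?thesis unfolding p_balanced_def by (auto intro: dvd_add)
  qed
  ultimately have "?f \<in> {f \<in> A_s m n. p_balanced p m n f}"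
    by (simp add: A_s_def xy_polys_polys_in)
  then show ?thesis unfolding A_s_p_def by (rule algebra_generated_inc)
qed

section \<open>Identifying \<open>x\<^sub>i\<close> with \<open>y\<^sub>i\<close>\<close>

definition specialise :: "nat \<Rightarrow> nat \<Rightarrow> 'k::field mpoly \<Rightarrow> 'k mpoly" where
  "specialise m k = subst (\<lambda>i. if m < i \<and> i \<le> m + k then var (i - m) else var i)"

lemma rhom_specialise: "rhom (specialise m k)"
  unfolding specialise_def by (rule rhom_subst)

lemma specialise_const: "specialise m k (const c) = const c"
  by (simp add: specialise_def subst_simps)

lemma specialise_images:
  "i \<in> {1..m} \<Longrightarrow> specialise m k (var i) = var i"
  "j \<in> {1..k} \<Longrightarrow> specialise m k (var (m + j)) = var j"
  "i > m + k \<Longrightarrow> specialise m k (var i) = var i"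
  by (auto simp: specialise_def subst_simps)

text \<open>
  The \<open>y\<close>-block turns into \<open>{x\<^sub>1, \<dots>, x\<^sub>k} \<union> {y\<^sub>k\<^sub>+\<^sub>1, \<dots>, y\<^sub>n}\<close>.
\<close>

lemma specialise_block:
  assumes "k \<le> n"
  shows "E_fps {m + 1..m + n} (\<lambda>i. specialise m k (var i :: 'k::field mpoly)) = E_fps {1..k} var * E_fps {m + k + 1..m + n} var"
    and "H_fps {m + 1..m + n} (\<lambda>i. specialise m k (var i :: 'k mpoly)) = H_fps {1..k} var * H_fps {m + k + 1..m + n} var"
proof -
  let ?s = "\<lambda>i. specialise m k (var i) :: 'k mpoly"
  have Y: "{m + 1..m + n} = {m + 1..m + k} \<union> {m + k + 1..m + n}" using assms by auto
  have bij: "bij_betw (\<lambda>j. m + j) {1..k} {m + 1..m + k}"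
    by (rule bij_betw_byWitness[where f' = "\<lambda>i. i - m"]) auto
  have "E_fps {m + 1..m + k} ?s = E_fps {1..k} var"
    unfolding E_fps_reindex[OF bij, symmetric] by (rule E_fps_cong) (simp add: specialise_images)
  moreover have "H_fps {m + 1..m + k} ?s = H_fps {1..k} var"
    unfolding H_fps_reindex[OF bij, symmetric] by (rule H_fps_cong) (simp add: specialise_images)
  moreover have "E_fps {m + k + 1..m + n} ?s = E_fps {m + k + 1..m + n} var"
    by (rule E_fps_cong) (simp add: specialise_images)
  moreover have "H_fps {m + k + 1..m + n} ?s = H_fps {m + k + 1..m + n} var"
    by (rule H_fps_cong) (simp add: specialise_images)
  ultimately show "E_fps {m + 1..m + n} ?s = E_fps {1..k} var * E_fps {m + k + 1..m + n} var"
    "H_fps {m + 1..m + n} ?s = H_fps {1..k} var * H_fps {m + k + 1..m + n} var"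
    unfolding Y by (subst E_fps_Un, auto) (subst H_fps_Un, auto)
qed

lemma specialise_c_gen:
  assumes k: "k \<le> m" "k \<le> n"
  shows "specialise m k (c_gen m n r) = fps_nth (C_fps {k + 1..m} {m + k + 1..m + n} var) r"
proof -
  let ?s = "\<lambda>i. specialise m k (var i) :: 'a mpoly"
  have X: "{1..m} = {1..k} \<union> {k + 1..m}" using k by auto
  have "E_fps {1..m} ?s = E_fps {1..m} var"
    by (rule E_fps_cong) (simp add: specialise_images)
  also have "\<dots> = E_fps {1..k} var * E_fps {k + 1..m} var"
    unfolding X by (rule E_fps_Un) auto
  finally have "C_fps {1..m} {m + 1..m + n} ?s =
      (E_fps {1..k} var * H_fps {1..k} var) * (E_fps {k + 1..m} var * H_fps {m + k + 1..m + n} var)"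
    unfolding C_fps_def specialise_block[OF k(2)] by (simp only: mult_ac)
  then show ?thesis
    unfolding rhom_c_gen[OF rhom_specialise] by (simp add: E_fps_H_fps C_fps_def)
qed

lemma specialise_power_elem_sym:
  assumes p: "CHAR('k::field) = p" "prime p" and k: "k \<le> n"
  shows "specialise m k ((elem_sym {m + 1..m + n} j :: 'k mpoly) ^ p) =
    (\<Sum>a=0..j. elem_sym {1..k} (j - a) ^ p * elem_sym {m + k + 1..m + n} a ^ p)"
proof -
  have q: "prime CHAR('k mpoly)" "p = CHAR('k mpoly)" using p by (simp_all add: CHAR_mpoly)
  have "specialise m k (elem_sym {m + 1..m + n} j :: 'k mpoly) =
      fps_nth (E_fps {m + k + 1..m + n} var * E_fps {1..k} var) j"
    unfolding rhom_elem_sym[OF rhom_specialise finite_atLeastAtMost] specialise_block(1)[OF k]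
    by (subst mult.commute) (rule refl)
  also have "\<dots> = (\<Sum>a=0..j. elem_sym {1..k} (j - a) * elem_sym {m + k + 1..m + n} a)"
    unfolding fps_mult_nth elem_sym_eq_E_fps[OF finite_atLeastAtMost]
    by (intro sum.cong refl mult.commute)
  finally show ?thesis
    by (simp add: rhom_power[OF rhom_specialise] q(2) freshmans_dream_sum[OF q(1) refl] power_mult_distrib)
qed

section \<open>Divisibility by the resultant\<close>

abbreviation identify :: "nat \<Rightarrow> nat \<Rightarrow> 'k::field mpoly \<Rightarrow> 'k mpoly" where
  "identify x y \<equiv> subst (\<lambda>l. if l = y then var x else var l)"

text \<open>
  The factor theorem: \<open>f\<close> is congruent to \<open>identify x y f\<close> modulo \<open>x - y\<close>. In particular a polynomial that
  vanishes under the identification is a multiple of \<open>x - y\<close>.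
\<close>

lemma var_diff_dvd_identify: "(var x - var y) dvd (f - identify x y f)"
proof -
  let ?d = "var x - var y :: 'a mpoly"
  have "subalgebra {f. ?d dvd (f - identify x y f)}"
  proof (rule subalgebraI; clarify)
    show "?d dvd const c - identify x y (const c)" for c by (simp add: subst_simps)
    fix f g assume fg: "?d dvd f - identify x y f" "?d dvd g - identify x y g"
    have "f + g - identify x y (f + g) = (f - identify x y f) + (g - identify x y g)"
      by (simp add: subst_simps)
    then show "?d dvd f + g - identify x y (f + g)" using fg by (simp only:) (intro dvd_add)
    have "f * g - identify x y (f * g) = (f - identify x y f) * g + identify x y f * (g - identify x y g)"
      by (simp add: subst_simps algebra_simps)
    then show "?d dvd f * g - identify x y (f * g)" using fg by (simp only:) (intro dvd_add dvd_mult dvd_mult2)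
  qed
  moreover have "var i \<in> {f. ?d dvd (f - identify x y f)}" for i
  proof -
    have "?d dvd - ?d" by (simp only: dvd_minus_iff dvd_refl)
    then have "?d dvd var y - var x" by (simp only: minus_diff_eq)
    then show ?thesis by (simp add: subst_simps)
  qed
  ultimately show ?thesis
    using polys_in_subset_subalgebra[of "{f. ?d dvd (f - identify x y f)}" UNIV] polys_in_UNIV by blast
qed

lemma var_eq_iff [simp]: "var i = (var j :: 'k::field mpoly) \<longleftrightarrow> i = j"
proof
  assume "var i = (var j :: 'k mpoly)"
  then have "Poly_Mapping.keys (var i :: 'k mpoly) = Poly_Mapping.keys (var j :: 'k mpoly)" by simp
  then have "Poly_Mapping.single i (1::nat) = Poly_Mapping.single j 1" by (simp add: var_def)
  then show "i = j" by (metis keys_single singleton_inject one_neq_zero)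
qed simp

lemma resultant_xy_nonzero:
  "finite X \<Longrightarrow> finite Y \<Longrightarrow> X \<inter> Y = {} \<Longrightarrow> (resultant_xy X Y :: 'k::field mpoly) \<noteq> 0"
  unfolding resultant_xy_def by (auto simp: prod_zero_iff)

text \<open>
  The linear factors are split off one at a time. A factor that has already been split off does
  not vanish under the next identification, so the remaining cofactor does.
\<close>

lemma resultant_xy_dvd:
  fixes F :: "'k::field mpoly"
  assumes fin: "finite X" "finite Y" and disj: "X \<inter> Y = {}"
    and zero: "\<And>x y. x \<in> X \<Longrightarrow> y \<in> Y \<Longrightarrow> identify x y F = 0"
  shows "resultant_xy X Y dvd F"
proof -
  have "(\<Prod>(x, y)\<in>Q. var x - var y) dvd F" if "Q \<subseteq> X \<times> Y" for Q
    using finite_subset[OF that finite_cartesian_product[OF fin]] that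
  proof (induction Q rule: finite_induct)
    case (insert xy Q)
    obtain x y where xy: "xy = (x, y)" by (cases xy)
    obtain g where g: "F = (\<Prod>(x, y)\<in>Q. var x - var y) * g" using insert by (auto elim: dvdE)
    have mem: "x \<in> X" "y \<in> Y" using insert.prems xy by auto
    have "identify x y (\<Prod>(x, y)\<in>Q. var x - var y :: 'k mpoly) =
        (\<Prod>(a, b)\<in>Q. identify x y (var a) - identify x y (var b))"
      by (simp add: rhom_prod[OF rhom_subst] case_prod_unfold rhom_diff[OF rhom_subst])
    also have "\<dots> \<noteq> 0"
    proof -
      have "identify x y (var a) \<noteq> (identify x y (var b) :: 'k mpoly)" if "(a, b) \<in> Q" for a b
      proof -
        have "a \<in> X" "b \<in> Y" "(a, b) \<noteq> (x, y)" using that insert.prems insert.hyps xy by auto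
        then show ?thesis using disj mem by (auto simp: subst_simps)
      qed
      then show ?thesis using insert.hyps by (auto simp: prod_zero_iff)
    qed
    moreover have "identify x y (\<Prod>(x, y)\<in>Q. var x - var y) * identify x y g = 0"
      using zero[OF mem] unfolding g by (simp add: subst_simps(4))
    ultimately have "identify x y g = 0" by simp
    then obtain h where "g = (var x - var y) * h"
      using var_diff_dvd_identify[of x y g] by (auto elim: dvdE)
    then have "F = (\<Prod>(x, y)\<in>insert xy Q. var x - var y) * h"
      using insert.hyps by (simp add: g xy mult_ac)
    then show ?case by simp
  qed simp
  from this[of "X \<times> Y"] show ?thesis
    by (simp add: resultant_xy_def prod.cartesian_product)
qed

section \<open>Partial derivatives in characteristic p\<close>

text \<open>
  The counterpart of \<open>subst_x1_y1\<close> for a single variable; its derivative is the partial derivative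
  with respect to that variable.
\<close>

definition poly_in_var :: "nat \<Rightarrow> 'k::field mpoly \<Rightarrow> 'k mpoly poly" where
  "poly_in_var i = substitute (\<lambda>c. [:const c:]) (\<lambda>l. if l = i then [:0, 1:] else [:var l:])"

lemma rhom_poly_in_var: "rhom (poly_in_var i)"
  unfolding poly_in_var_def by (rule rhom_substitute[OF rhom_const_poly])

lemma poly_in_var_var: "poly_in_var i (var l) = (if l = i then [:0, 1:] else [:var l:])"
  and poly_in_var_const: "poly_in_var i (const c) = [:const c:]"
  by (simp_all add: poly_in_var_def substitute_var[OF rhom_const_poly] substitute_const[OF rhom_const_poly])

lemma poly_in_var_lift: "f \<in> polys_in (- {i}) \<Longrightarrow> poly_in_var i f = [:f:]"
  by (rule rhom_eqI[OF rhom_poly_in_var rhom_coeff_lift]) (auto simp: poly_in_var_var poly_in_var_const)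

lemma poly_in_var_single:
  "poly_in_var i (Poly_Mapping.single \<alpha> c) =
    Polynomial.monom (Poly_Mapping.single (Poly_Mapping.update i 0 \<alpha>) c) (Poly_Mapping.lookup \<alpha> i)"
proof -
  let ?\<beta> = "Poly_Mapping.update i 0 \<alpha>"
  have "\<alpha> = ?\<beta> + Poly_Mapping.single i (Poly_Mapping.lookup \<alpha> i)"
    by (rule poly_mapping_eqI) (auto simp: lookup_add lookup_update lookup_single when_def)
  then have "Poly_Mapping.single \<alpha> c = Poly_Mapping.single ?\<beta> c * var i ^ Poly_Mapping.lookup \<alpha> i"
    by (simp add: power_var mult_single)
  moreover have "Poly_Mapping.single ?\<beta> c \<in> polys_in (- {i})"
    by (auto simp: polys_in_def in_keys_iff lookup_update split: if_splits)
  ultimately show ?thesis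
    by (simp add: rhomD[OF rhom_poly_in_var] rhom_power[OF rhom_poly_in_var] poly_in_var_lift poly_in_var_var monom_altdef)
qed

text \<open>
  The coefficient of the \<open>k\<close>-th power of the variable enters the derivative multiplied by \<open>k\<close>, which
  is nonzero in characteristic \<open>p\<close> unless \<open>p\<close> divides \<open>k\<close>.
\<close>

lemma pderiv_poly_in_var_eq_0:
  fixes f :: "'k::field mpoly"
  assumes p: "CHAR('k) = p" and f: "pderiv (poly_in_var i f) = 0"
  shows "f \<in> exps_dvd p i"
  unfolding exps_dvd_def
proof clarify
  fix \<alpha> assume \<alpha>: "\<alpha> \<in> Poly_Mapping.keys f"
  let ?k = "Poly_Mapping.lookup \<alpha> i"
  show "p dvd ?k"
  proof (rule ccontr)
    assume np: "\<not> p dvd ?k"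
    then obtain l where l: "?k = Suc l" by (cases ?k) auto
    have "of_nat ?k \<noteq> (0 :: 'k mpoly)"
      using np p by (simp add: of_nat_eq_0_iff_char_dvd CHAR_mpoly)
    moreover have "of_nat ?k * coeff (poly_in_var i f) ?k = 0"
      using f coeff_pderiv[of "poly_in_var i f" l] l by simp
    ultimately have "coeff (poly_in_var i f) ?k = 0" by simp
    moreover have "poly_in_var i f = (\<Sum>\<beta>\<in>Poly_Mapping.keys f. Polynomial.monom
        (Poly_Mapping.single (Poly_Mapping.update i 0 \<beta>) (Poly_Mapping.lookup f \<beta>)) (Poly_Mapping.lookup \<beta> i))"
      by (subst monomial_sum[of f]) (simp add: rhom_sum[OF rhom_poly_in_var] poly_in_var_single)
    ultimately have "0 = Poly_Mapping.lookup (\<Sum>\<beta>\<in>Poly_Mapping.keys f.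
        if Poly_Mapping.lookup \<beta> i = ?k
        then Poly_Mapping.single (Poly_Mapping.update i 0 \<beta>) (Poly_Mapping.lookup f \<beta>) else 0)
        (Poly_Mapping.update i 0 \<alpha>)"
      by (simp add: coeff_sum)
    also have "\<dots> = (\<Sum>\<beta>\<in>Poly_Mapping.keys f. if \<beta> = \<alpha> then Poly_Mapping.lookup f \<beta> else 0)"
      unfolding lookup_sum
    proof (intro sum.cong refl)
      fix \<beta>
      have "\<beta> = \<alpha>" if "Poly_Mapping.lookup \<beta> i = ?k"
        "Poly_Mapping.update i 0 \<beta> = Poly_Mapping.update i 0 \<alpha>"
      proof (rule poly_mapping_eqI)
        fix l
        have "Poly_Mapping.lookup (Poly_Mapping.update i 0 \<beta>) l = Poly_Mapping.lookup (Poly_Mapping.update i 0 \<alpha>) l"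
          using that(2) by simp
        then show "Poly_Mapping.lookup \<beta> l = Poly_Mapping.lookup \<alpha> l"
          using that(1) by (auto simp: lookup_update split: if_splits)
      qed
      then show "Poly_Mapping.lookup (if Poly_Mapping.lookup \<beta> i = ?k
          then Poly_Mapping.single (Poly_Mapping.update i 0 \<beta>) (Poly_Mapping.lookup f \<beta>) else 0)
          (Poly_Mapping.update i 0 \<alpha>) = (if \<beta> = \<alpha> then Poly_Mapping.lookup f \<beta> else 0)"
        by (auto simp: lookup_single when_def)
    qed
    also have "\<dots> = Poly_Mapping.lookup f \<alpha>" using \<alpha> by simp
    finally show False using \<alpha> by (simp add: in_keys_iff)
  qed
qed

lemma pderiv_map_poly:
  assumes h: "rhom h"
  shows "pderiv (map_poly h q) = map_poly h (pderiv q)"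
proof (rule poly_eqI)
  have "h (of_nat n) = of_nat n" for n
    by (induction n) (simp_all add: rhomD[OF h])
  then have "h (of_nat n * c) = of_nat n * h c" for n c
    by (simp add: rhomD[OF h])
  from this[of "Suc n" for n] show "coeff (pderiv (map_poly h q)) n = coeff (map_poly h (pderiv q)) n" for n
    by (simp add: coeff_pderiv coeff_map_poly rhomD[OF h] del: of_nat_Suc)
qed

section \<open>Symmetries of specialised polynomials\<close>

lemma A_s_swap:
  assumes "f \<in> A_s m n"
  shows "a \<in> {1..m} \<Longrightarrow> b \<in> {1..m} \<Longrightarrow> swap a b f = f"
    and "a \<in> {m + 1..m + n} \<Longrightarrow> b \<in> {m + 1..m + n} \<Longrightarrow> swap a b f = f"
proof -
  have "symmetric_in {1..m} f" "symmetric_in {m + 1..m + n} f"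
    using assms by (simp_all add: A_s_def)
  note s = this[unfolded symmetric_in_def, rule_format, OF permutes_swap_id]
  show "a \<in> {1..m} \<Longrightarrow> b \<in> {1..m} \<Longrightarrow> swap a b f = f" by (rule s(1))
  show "a \<in> {m + 1..m + n} \<Longrightarrow> b \<in> {m + 1..m + n} \<Longrightarrow> swap a b f = f" by (rule s(2))
qed

lemma specialise_swap_x:
  assumes f: "f \<in> A_s m n" and k: "k \<le> m" "k \<le> n" and ab: "a \<in> {k + 1..m}" "b \<in> {k + 1..m}"
  shows "swap a b (specialise m k f) = specialise m k f"
proof -
  have "swap a b (specialise m k f) = specialise m k (swap a b f)"
    unfolding specialise_def subst_subst using ab
    by (intro arg_cong[where f = "\<lambda>\<sigma>. subst \<sigma> f"] ext) (auto simp: subst_simps transpose_def)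
  then show ?thesis using A_s_swap(1)[OF f, of a b] ab by simp
qed

lemma specialise_swap_y:
  assumes f: "f \<in> A_s m n" and k: "k \<le> m" "k \<le> n" and ab: "a \<in> {m + k + 1..m + n}" "b \<in> {m + k + 1..m + n}"
  shows "swap a b (specialise m k f) = specialise m k f"
proof -
  have "swap a b (specialise m k f) = specialise m k (swap a b f)"
    unfolding specialise_def subst_subst using ab k
    by (intro arg_cong[where f = "\<lambda>\<sigma>. subst \<sigma> f"] ext) (auto simp: subst_simps transpose_def)
  then show ?thesis using A_s_swap(2)[OF f, of a b] ab by simp
qed

text \<open>
  For the identified variables \<open>x\<^sub>a\<close> and \<open>x\<^sub>b\<close> the exchange comes from exchanging \<open>x\<^sub>a, x\<^sub>b\<close> and
  \<open>y\<^sub>a, y\<^sub>b\<close> simultaneously.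
\<close>

lemma specialise_swap_t:
  assumes f: "f \<in> A_s m n" and k: "k \<le> m" "k \<le> n" and ab: "a \<in> {1..k}" "b \<in> {1..k}"
  shows "swap a b (specialise m k f) = specialise m k f"
proof -
  have "swap a b (specialise m k f) = specialise m k (swap a b (swap (m + a) (m + b) f))"
    unfolding specialise_def subst_subst using ab k
    by (intro arg_cong[where f = "\<lambda>\<sigma>. subst \<sigma> f"] ext) (auto simp: subst_simps transpose_def)
  then show ?thesis
    using A_s_swap(1)[OF f, of a b] A_s_swap(2)[OF f, of "m + a" "m + b"] ab k by simp
qed

lemma specialise_polys_in:
  assumes f: "f \<in> A_s m n" and k: "k \<le> m" "k \<le> n"
  shows "specialise m k f \<in> polys_in ({1..k} \<union> {k + 1..m} \<union> {m + k + 1..m + n})"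
  unfolding specialise_def
  by (rule subst_in_subalgebra[OF subalgebra_polys_in, of "{1..m + n}"])
     (use f k in \<open>auto simp: A_s_def xy_polys_polys_in intro!: var_in_polys_in\<close>)

text \<open>
  For \<open>i = 1\<close> this is the defining condition on supersymmetric polynomials, followed by
  the identification of further variables in the coefficients; the other \<open>i\<close> follow by symmetry.
\<close>

lemma pderiv_poly_in_var_specialise:
  fixes f :: "'k::field mpoly"
  assumes f: "f \<in> A_s m n" and k: "k \<le> m" "k \<le> n" and i: "i \<in> {1..k}"
  shows "pderiv (poly_in_var i (specialise m k f)) = 0"
proof -
  have 1: "poly_in_var 1 (specialise m k f) = map_poly (specialise m k) (subst_x1_y1 m f)"
  proof (rule rhom_eqI[OF rhom_comp[OF rhom_poly_in_var rhom_specialise]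
        rhom_comp[OF rhom_map_poly[OF rhom_specialise] rhom_subst_x1_y1] _ _ polys_in_UNIV])
    show "poly_in_var 1 (specialise m k (const c)) = map_poly (specialise m k) (subst_x1_y1 m (const c))" for c :: 'k
      by (simp add: specialise_const poly_in_var_const subst_x1_y1_def substitute_const[OF rhom_const_poly]
        map_poly_pCons rhomD[OF rhom_specialise])
    show "poly_in_var 1 (specialise m k (var l)) = map_poly (specialise m k) (subst_x1_y1 m (var l :: 'k mpoly))" for l
      using k i
      by (auto simp: specialise_def subst_simps poly_in_var_var subst_x1_y1_def substitute_var[OF rhom_const_poly]
        map_poly_pCons)
  qed
  have 2: "poly_in_var i (swap 1 i g) = map_poly (swap 1 i) (poly_in_var 1 g)" for g :: "'k mpoly"
    by (rule rhom_eqI[OF rhom_comp[OF rhom_poly_in_var rhom_subst]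
        rhom_comp[OF rhom_map_poly[OF rhom_subst] rhom_poly_in_var] _ _ polys_in_UNIV])
       (auto simp: subst_simps poly_in_var_const poly_in_var_var map_poly_pCons transpose_def)
  have "pderiv (subst_x1_y1 m f) = 0" using f by (simp add: A_s_def)
  then have "pderiv (poly_in_var 1 (specialise m k f)) = 0"
    unfolding 1 pderiv_map_poly[OF rhom_specialise] by simp
  then have "pderiv (poly_in_var i (swap 1 i (specialise m k f))) = 0"
    unfolding 2 pderiv_map_poly[OF rhom_subst] by simp
  moreover have "swap 1 i (specialise m k f) = specialise m k f"
    using specialise_swap_t[OF f k, of 1 i] i by simp
  ultimately show ?thesis by simp
qed

text \<open>
  The hypothesis is the vanishing for the single pair \<open>(x\<^sub>k\<^sub>+\<^sub>1, y\<^sub>k\<^sub>+\<^sub>1)\<close>; by symmetry it spreads to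
  all pairs.
\<close>

lemma resultant_dvd_specialise:
  assumes f: "f \<in> A_s m n" and k: "k < m" "k < n" and zero: "specialise m (Suc k) f = 0"
  shows "resultant_xy {k + 1..m} {m + k + 1..m + n} dvd specialise m k f"
proof (rule resultant_xy_dvd)
  let ?F = "specialise m k f"
  fix x y assume x: "x \<in> {k + 1..m}" and y: "y \<in> {m + k + 1..m + n}"
  let ?a = "k + 1" and ?b = "m + k + 1"
  have "identify ?a ?b ?F = specialise m (Suc k) f"
    unfolding specialise_def subst_subst using k
    by (intro arg_cong[where f = "\<lambda>\<sigma>. subst \<sigma> f"] ext) (auto simp: subst_simps)
  then have z: "identify ?a ?b ?F = 0" using zero by simp
  have "identify x y (swap ?a x (swap ?b y ?F)) = swap ?a x (swap ?b y (identify ?a ?b ?F))"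
    unfolding subst_subst using x y k
    by (intro arg_cong[where f = "\<lambda>\<sigma>. subst \<sigma> ?F"] ext) (auto simp: subst_simps transpose_def)
  moreover have "swap ?b y ?F = ?F" by (rule specialise_swap_y[OF f]) (use k y in auto)
  moreover have "swap ?a x ?F = ?F" by (rule specialise_swap_x[OF f]) (use k x in auto)
  ultimately show "identify x y ?F = 0" by (simp only: z rhomD(1)[OF rhom_subst])
qed (use k in auto)

lemma swap_resultant_xy:
  assumes "finite X" "finite Y" "X \<inter> Y = {}"
    and "(a \<in> X \<and> b \<in> X) \<or> (a \<in> Y \<and> b \<in> Y) \<or> (a \<notin> X \<union> Y \<and> b \<notin> X \<union> Y)"
  shows "swap a b (resultant_xy X Y) = (resultant_xy X Y :: 'k::field mpoly)"
proof -
  let ?t = "transpose a b"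
  have bij: "bij_betw ?t X X" "bij_betw ?t Y Y"
    using assms by (auto intro!: bij_betw_byWitness[where f' = ?t] simp: transpose_def split: if_splits)
  have "swap a b (resultant_xy X Y) = (\<Prod>x\<in>X. \<Prod>y\<in>Y. var (?t x) - var (?t y) :: 'k mpoly)"
    by (simp add: resultant_xy_def rhom_prod[OF rhom_subst] rhom_diff[OF rhom_subst] subst_simps)
  also have "\<dots> = (\<Prod>x\<in>X. \<Prod>y\<in>Y. var (?t x) - var y)"
    by (intro prod.cong refl prod.reindex_bij_betw[OF bij(2), of "\<lambda>y. var _ - var y"])
  also have "\<dots> = resultant_xy X Y"
    unfolding resultant_xy_def by (rule prod.reindex_bij_betw[OF bij(1), of "\<lambda>x. \<Prod>y\<in>Y. var x - var y"])
  finally show ?thesis .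
qed

text \<open>
  Cancelling the resultant, which is invariant under the symmetries in question and constant with
  respect to the variables in \<open>T\<close>, shows that the cofactor inherits the symmetries and the
  vanishing derivatives of \<open>specialise m k f\<close>.
\<close>

lemma specialise_factorisation:
  fixes f :: "'k::field mpoly"
  assumes p: "CHAR('k) = p" "prime p"
    and f: "f \<in> A_s m n" and k: "k \<le> m" "k \<le> n" and zero: "k < m \<and> k < n \<Longrightarrow> specialise m (Suc k) f = 0"
  defines "T \<equiv> {1..k}" and "X \<equiv> {k + 1..m}" and "Y \<equiv> {m + k + 1..m + n}"
  shows "\<exists>g\<in>alg (range (\<lambda>j. elem_sym T j ^ p) \<union> range (elem_sym X) \<union> range (elem_sym Y)).
    specialise m k f = resultant_xy X Y * g"
proof -
  let ?R = "resultant_xy X Y :: 'k mpoly"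
  let ?W = "T \<union> X \<union> Y"
  have fin: "finite X" "finite Y" "X \<inter> Y = {}" "T \<inter> (X \<union> Y) = {}" "finite T"
    using k by (auto simp: X_def Y_def T_def)
  have R0: "?R \<noteq> 0" using resultant_xy_nonzero fin by blast
  have RW: "?R \<in> polys_in (X \<union> Y)"
    unfolding resultant_xy_def
    by (intro subalgebra_prod[OF subalgebra_polys_in] subalgebraD(5)[OF subalgebra_polys_in] var_in_polys_in) auto
  have "?R dvd specialise m k f"
  proof (cases "k < m \<and> k < n")
    case True
    then show ?thesis unfolding X_def Y_def by (intro resultant_dvd_specialise[OF f] zero) auto
  next
    case False
    then have "X = {} \<or> Y = {}" using k by (auto simp: X_def Y_def)
    then show ?thesis by (auto simp: resultant_xy_def)
  qed
  then obtain g0 where g0: "specialise m k f = ?R * g0" by (auto elim: dvdE)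
  \<comment> \<open>sets the variables outside the three blocks to 0, which puts the cofactor into the right
    polynomial ring and fixes the other two polynomials\<close>
  define \<kappa> where "\<kappa> = (\<lambda>i. if i \<in> ?W then var i else 0 :: 'k mpoly)"
  define g where "g = subst \<kappa> g0"
  have kappa: "subst \<kappa> h = h" if "h \<in> polys_in ?W" for h
    using subst_cong[OF that, of \<kappa> var] by (simp add: \<kappa>_def)
  have "?R \<in> polys_in ?W" using RW by (auto simp: polys_in_def)
  moreover have "specialise m k f \<in> polys_in ?W"
    using specialise_polys_in[OF f k] by (simp add: T_def X_def Y_def)
  ultimately have g: "specialise m k f = ?R * g"
    using arg_cong[OF g0, of "subst \<kappa>"] by (simp add: subst_simps kappa g_def)
  have gW: "g \<in> polys_in ?W"
    unfolding g_def \<kappa>_def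
    by (rule subst_in_subalgebra[OF subalgebra_polys_in _ polys_in_UNIV])
       (auto intro: var_in_polys_in subalgebraD(2)[OF subalgebra_polys_in])
  have swap: "swap a b g = g"
    if "(a \<in> X \<and> b \<in> X) \<or> (a \<in> Y \<and> b \<in> Y) \<or> (a \<in> T \<and> b \<in> T)" for a b
  proof -
    have "swap a b (specialise m k f) = specialise m k f"
      using that specialise_swap_x[OF f k, of a b] specialise_swap_y[OF f k, of a b] specialise_swap_t[OF f k, of a b]
      by (auto simp: X_def Y_def T_def)
    moreover have "swap a b ?R = ?R"
      using that fin by (intro swap_resultant_xy) auto
    ultimately have "?R * swap a b g = ?R * g" by (simp add: g subst_simps)
    then show ?thesis using R0 by simp
  qed
  have dvd: "g \<in> exps_dvd p i" if i: "i \<in> T" for i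
  proof (rule pderiv_poly_in_var_eq_0[OF p(1)])
    have "?R \<in> polys_in (- {i})" using RW fin(4) i by (auto simp: polys_in_def)
    then have "poly_in_var i (specialise m k f) = Polynomial.smult ?R (poly_in_var i g)"
      by (simp add: g rhomD[OF rhom_poly_in_var] poly_in_var_lift)
    then have "Polynomial.smult ?R (pderiv (poly_in_var i g)) = 0"
      using pderiv_poly_in_var_specialise[OF f k, of i] i by (simp add: pderiv_smult T_def)
    then show "pderiv (poly_in_var i g) = 0" using R0 by simp
  qed
  define V where "V i = (if i = 0 then T else if i = 1 then X else Y)" for i :: nat
  define q where "q i = (if i = 0 then p else 1)" for i :: nat
  have "g \<in> alg (\<Union>i\<in>{0, 1, 2}. range (\<lambda>j. elem_sym (V i) j ^ q i))"
  proof (rule multisymmetric_fundamental)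
    show "g \<in> polys_in (\<Union>i\<in>{0, 1, 2}. V i)"
    proof -
      have "(\<Union>i\<in>{0, 1, 2}. V i) = ?W" by (auto simp: V_def)
      then show ?thesis using gW by simp
    qed
    show "g \<in> exps_dvd (q i) v" if "i \<in> {0, 1, 2}" "v \<in> V i" for i v
      using that dvd by (auto simp: q_def V_def exps_dvd_def)
  qed (use fin p swap in \<open>auto simp: V_def q_def\<close>)
  moreover have "(\<Union>i\<in>{0, 1, 2}. range (\<lambda>j. elem_sym (V i) j ^ q i :: 'k mpoly)) =
      range (\<lambda>j. elem_sym T j ^ p) \<union> range (elem_sym X) \<union> range (elem_sym Y)"
    by (auto simp: V_def q_def)
  ultimately show ?thesis using g by auto
qed

section \<open>Lifting multiples of the resultant\<close>

text \<open>
  The lift of \<open>R\<close> times an element of the algebra generated by the \<open>\<sigma>\<^sub>j(X)\<close> and \<open>\<sigma>\<^sub>j(Y)\<close> comes from the \<open>c\<^sub>r\<close>. To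
  include the factors \<open>\<sigma>\<^sub>j(T)\<^sup>p\<close>, consider all \<open>h\<close> for which \<open>R u h\<close> can be lifted for every \<open>u\<close>
  in that algebra. The freedom in \<open>u\<close> is what allows the terms \<open>\<sigma>\<^sub>a(Y)\<^sup>p\<close> to be moved out of the way.
\<close>

lemma resultant_multiple_in_specialise_image:
  fixes g :: "'k::field mpoly"
  assumes p: "CHAR('k) = p" "prime p" and k: "k \<le> m" "k \<le> n"
    and G: "subalgebra G" "range (c_gen m n) \<subseteq> G" "\<And>j. elem_sym {m + 1..m + n} j ^ p \<in> G"
  defines "T \<equiv> {1..k}" and "X \<equiv> {k + 1..m}" and "Y \<equiv> {m + k + 1..m + n}"
  assumes g: "g \<in> alg (range (\<lambda>j. elem_sym T j ^ p) \<union> range (elem_sym X) \<union> range (elem_sym Y))"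
  shows "resultant_xy X Y * g \<in> specialise m k ` G"
proof -
  let ?R = "resultant_xy X Y :: 'k mpoly"
  let ?I = "specialise m k ` G"
  let ?Z = "alg (range (elem_sym X) \<union> range (elem_sym Y)) :: 'k mpoly set"
  have I: "subalgebra ?I" by (rule subalgebra_image[OF G(1) rhom_specialise specialise_const])
  have Z: "subalgebra ?Z" by (rule algebra_generated_subalgebra)
  have fin: "finite X" "finite Y" by (simp_all add: X_def Y_def)
  have "fps_nth (C_fps X Y var) r \<in> ?I" for r
    using specialise_c_gen[OF k, of r, symmetric] G(2) unfolding X_def Y_def by blast
  then have "alg (range (fps_nth (C_fps X Y var))) \<subseteq> ?I"
    by (intro algebra_generated_minimal[OF I]) auto
  then have RZ: "?R * u \<in> ?I" if "u \<in> ?Z" for u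
    using resultant_multiple_in_alg_C[OF fin that] by blast
  define M where "M = {h. \<forall>u\<in>?Z. ?R * (u * h) \<in> ?I}"
  have ZM: "z * h \<in> M" if "z \<in> ?Z" "h \<in> M" for z h
    unfolding M_def
  proof clarify
    fix u assume "u \<in> ?Z"
    then have "u * z \<in> ?Z" using that(1) by (rule subalgebraD(6)[OF Z])
    then have "?R * (u * z * h) \<in> ?I" using that(2) unfolding M_def by blast
    then show "?R * (u * (z * h)) \<in> ?I" by (simp only: mult.assoc)
  qed
  have add: "h + h' \<in> M" "h - h' \<in> M" if "h \<in> M" "h' \<in> M" for h h'
    using that by (auto simp: M_def distrib_left right_diff_distrib intro: subalgebraD[OF I])
  have "0 \<in> M" using subalgebraD(2)[OF I] by (simp add: M_def)
  then have sum: "(\<And>a. a \<in> A \<Longrightarrow> F a \<in> M) \<Longrightarrow> sum F A \<in> M" for F and A :: "nat set"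
    by (induction A rule: infinite_finite_induct) (auto intro: add)
  have T: "elem_sym T j ^ p * h \<in> M" if "h \<in> M" for j h
    using that
  proof (induction j arbitrary: h rule: less_induct)
    case (less j)
    let ?e = "\<lambda>a. elem_sym Y a ^ p :: 'k mpoly"
    let ?s = "\<lambda>a. elem_sym T a ^ p :: 'k mpoly"
    let ?Q = "\<Sum>a=0..j. ?s (j - a) * ?e a"
    have "?Q \<in> ?I"
      using specialise_power_elem_sym[OF p k(2), of m j, symmetric] G(3)[of j] unfolding T_def Y_def by blast
    then have Q: "?Q * h \<in> M"
      using less.prems subalgebraD(6)[OF I] by (auto simp: M_def mult.left_commute[of _ ?Q])
    have "?s (j - a) * (?e a * h) \<in> M" if "a \<in> {1..j}" for a
    proof (rule less.IH)
      show "j - a < j" using that by auto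
      have "?e a \<in> ?Z" by (intro subalgebra_power[OF Z] algebra_generated_inc) auto
      then show "?e a * h \<in> M" using less.prems by (rule ZM)
    qed
    then have rest: "(\<Sum>a=1..j. ?s (j - a) * (?e a * h)) \<in> M" by (rule sum)
    \<comment> \<open>the term \<open>a = 0\<close> is the wanted one since \<open>\<sigma>\<^sub>0(Y) = 1\<close>\<close>
    have "?Q = ?s j + (\<Sum>a=1..j. ?s (j - a) * ?e a)"
      by (simp add: sum.atLeast_Suc_atMost elem_sym_0 fin)
    then have "?s j * h = ?Q * h - (\<Sum>a=1..j. ?s (j - a) * (?e a * h))"
      by (simp add: distrib_right sum_distrib_right mult.assoc)
    then show ?case using add(2)[OF Q rest] by simp
  qed
  define N where "N = {w. \<forall>h\<in>M. w * h \<in> M}"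
  have "subalgebra N"
  proof (rule subalgebraI)
    show "const c \<in> N" for c
      using ZM subalgebraD(1)[OF Z] by (auto simp: N_def)
    show "f + g \<in> N" if "f \<in> N" "g \<in> N" for f g
      using that add by (auto simp: N_def distrib_right)
    show "f * g \<in> N" if "f \<in> N" "g \<in> N" for f g
      using that by (auto simp: N_def mult.assoc)
  qed
  moreover have "range (\<lambda>j. elem_sym T j ^ p) \<union> range (elem_sym X) \<union> range (elem_sym Y) \<subseteq> N"
  proof -
    have "elem_sym X j \<in> ?Z" "elem_sym Y j \<in> ?Z" for j
      by (auto intro: algebra_generated_inc)
    then show ?thesis using T ZM by (auto simp: N_def)
  qed
  ultimately have "alg (range (\<lambda>j. elem_sym T j ^ p) \<union> range (elem_sym X) \<union> range (elem_sym Y)) \<subseteq> N"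
    by (rule algebra_generated_minimal)
  then have "g \<in> N" using g by blast
  moreover have "1 \<in> M" using RZ by (simp add: M_def)
  ultimately have "g * 1 \<in> M" unfolding N_def by blast
  then have "\<forall>u\<in>?Z. ?R * (u * g) \<in> ?I" by (simp only: M_def mem_Collect_eq mult_1_right)
  then have "?R * (1 * g) \<in> ?I" using subalgebraD(3)[OF Z] by (rule bspec)
  then show ?thesis by simp
qed

theorem theorem1:
  fixes m n p :: nat
  assumes "CHAR('k::alg_closed_field) = p"
    and "p > 0" and "p \<noteq> 2"
    and "m \<ge> 1" and "n \<ge> 1"
  shows "(A_s m n :: 'k mpoly set) =
    algebra_generated (A_s_p p m n) (range (c_gen m n))"
proof
  let ?A = "A_s m n :: 'k mpoly set"
  let ?G = "algebra_generated (A_s_p p m n) (range (c_gen m n)) :: 'k mpoly set"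
  have p: "CHAR('k) = p" "prime p"
    using assms(1,2) prime_CHAR_semidom[where 'a = 'k] by auto
  have A: "subalgebra ?A" by (rule subalgebra_A_s)
  have "subalgebra_over (A_s_p p m n) ?A"
    using A A_s_p_subset_A_s unfolding subalgebra_over_def by blast
  then show GA: "?G \<subseteq> ?A"
    using c_gen_in_A_s[OF assms(4,5)] by (intro algebra_generated_minimal) auto
  have Gp: "subalgebra_over (A_s_p p m n) ?G" by (rule algebra_generated_subalgebra)
  have "range const \<subseteq> (A_s_p p m n :: 'k mpoly set)"
    using algebra_generated_subalgebra unfolding A_s_p_def subalgebra_over_def by blast
  then have G: "subalgebra ?G" by (rule subalgebra_over_mono[OF Gp])
  have Gc: "range (c_gen m n) \<subseteq> ?G" by (rule algebra_generated_superset)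
  have Ge: "elem_sym {m + 1..m + n} j ^ p \<in> ?G" for j
    using power_elem_sym_in_A_s_p[OF p] Gp unfolding subalgebra_over_def by blast
  have lift: "\<exists>e\<in>?G. specialise m k f = specialise m k e"
    if f: "f \<in> ?A" "k \<le> m" "k \<le> n" "k < m \<and> k < n \<Longrightarrow> specialise m (Suc k) f = 0" for f k
  proof -
    obtain g where g: "g \<in> alg (range (\<lambda>j. elem_sym {1..k} j ^ p) \<union> range (elem_sym {k + 1..m}) \<union>
        range (elem_sym {m + k + 1..m + n}))"
      "specialise m k f = resultant_xy {k + 1..m} {m + k + 1..m + n} * g"
      using specialise_factorisation[OF p f] by blast
    show ?thesis
      using resultant_multiple_in_specialise_image[OF p f(2,3) G Gc Ge g(1)] g(2) by auto
  qed
  \<comment> \<open>descending along the chain of kernels; the kernel for \<open>k = 0\<close> is trivial\<close>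
  have kernel: "f \<in> ?G" if "f \<in> ?A" "k \<le> m" "k \<le> n" "specialise m k f = 0" for f k
    using that
  proof (induction k arbitrary: f)
    case 0
    have "(\<lambda>i. if m < i \<and> i \<le> m + 0 then var (i - m) else var i) = (var :: nat \<Rightarrow> 'k mpoly)"
      by auto
    then have "specialise m 0 f = f" by (simp only: specialise_def subst_var)
    then show ?case using 0 subalgebraD(2)[OF G] by simp
  next
    case (Suc k)
    obtain e where e: "e \<in> ?G" "specialise m k f = specialise m k e"
      using lift[of f k] Suc.prems by auto
    have "f - e \<in> ?A" using e(1) GA Suc.prems(1) by (blast intro: subalgebraD[OF A])
    moreover have "specialise m k (f - e) = 0" using e(2) by (simp add: rhom_diff[OF rhom_specialise])
    ultimately have "f - e \<in> ?G" using Suc.IH Suc.prems by simp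
    then have "f - e + e \<in> ?G" using e(1) by (rule subalgebraD(4)[OF G])
    then show ?case by simp
  qed
  show "?A \<subseteq> ?G"
  proof
    fix f assume f: "f \<in> ?A"
    let ?k = "min m n"
    have "\<not> (?k < m \<and> ?k < n)" by auto
    then obtain e where e: "e \<in> ?G" "specialise m ?k f = specialise m ?k e"
      using lift[OF f, of ?k] min.cobounded1[of m n] min.cobounded2[of m n] by blast
    have "f - e \<in> ?A" using e(1) GA f by (blast intro: subalgebraD[OF A])
    moreover have "specialise m ?k (f - e) = 0" using e(2) by (simp add: rhom_diff[OF rhom_specialise])
    ultimately have "f - e \<in> ?G" using kernel[of "f - e" ?k] by simp
    then have "f - e + e \<in> ?G" using e(1) by (rule subalgebraD(4)[OF G])
    then show "f \<in> ?G" by simp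
  qed
qed

end
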